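(* Let $n$ items have inclusion probabilities $w_1,\dots,w_n\in[0,1]$, $W=\sum_i w_i$, and suppose the items are distributed randomly over $p$ PEs of a distributed-memory machine. Then weighted subset sampling (outputting a random subset $S$ with each item $i$ included independently with probability $w_i$) can be done in a communication-free way with expected preprocessing overhead $O(n/p+\log p)$ and expected sampling time $O(W/p+\log p)$.
   Context: Random distribution: each item is placed on an independently and uniformly chosen PE. Communication-free means the PEs exchange no messages; each PE outputs the part of the sample consisting of its own items. *)

theory Defs
  imports "HOL-Probability.Probability"
begin

text \<open>
  Each PE is a sequential real RAM with natural-number and real cells (exact real arithmetic,
  including \<open>exp\<close> and \<open>ln\<close>, but no rounding from reals to naturals). It is programmed in a structured
  language with named scalars and arrays. A program is a fixed finite text, so its expressions have
  constant size and every executed instruction or test is charged one unit of time.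
  There are no communication instructions: a communication-free algorithm is one such program run
  by all PEs independently, each on its private memory.
\<close>

datatype nexp =
    NConst nat
  | NVar nat
  | NArr nat nexp
  | NAdd nexp nexp
  | NSub nexp nexp

datatype rexp =
    RNat nexp
  | RVar nat
  | RArr nat nexp
  | RAdd rexp rexp
  | RSub rexp rexp
  | RMul rexp rexp
  | RDiv rexp rexp
  | RExp rexp
  | RLn rexp

datatype bexp =
    NLess nexp nexp
  | RLess rexp rexp
  | BNot bexp
  | BAnd bexp bexp

datatype com =
    Skip
  | NAssign nat nexp
  | NStore nat nexp nexp
  | RAssign nat rexp
  | RStore nat nexp rexp
  | Uniform nat nexp
  | Flip nat rexp
  | Emit nexp
  | Seq com com
  | If bexp com com
  | While bexp com

record state =
  nvar :: "nat \<Rightarrow> nat"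
  narr :: "nat \<Rightarrow> nat \<Rightarrow> nat"
  rvar :: "nat \<Rightarrow> real"
  rarr :: "nat \<Rightarrow> nat \<Rightarrow> real"
  emitted :: "nat list"
  clock :: nat

primrec nval :: "nexp \<Rightarrow> state \<Rightarrow> nat" where
  "nval (NConst c) s = c"
| "nval (NVar x) s = nvar s x"
| "nval (NArr a e) s = narr s a (nval e s)"
| "nval (NAdd e1 e2) s = nval e1 s + nval e2 s"
| "nval (NSub e1 e2) s = nval e1 s - nval e2 s"

primrec rval :: "rexp \<Rightarrow> state \<Rightarrow> real" where
  "rval (RNat e) s = real (nval e s)"
| "rval (RVar x) s = rvar s x"
| "rval (RArr a e) s = rarr s a (nval e s)"
| "rval (RAdd e1 e2) s = rval e1 s + rval e2 s"
| "rval (RSub e1 e2) s = rval e1 s - rval e2 s"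
| "rval (RMul e1 e2) s = rval e1 s * rval e2 s"
| "rval (RDiv e1 e2) s = rval e1 s / rval e2 s"
| "rval (RExp e) s = exp (rval e s)"
| "rval (RLn e) s = ln (rval e s)"

primrec bval :: "bexp \<Rightarrow> state \<Rightarrow> bool" where
  "bval (NLess e1 e2) s \<longleftrightarrow> nval e1 s < nval e2 s"
| "bval (RLess e1 e2) s \<longleftrightarrow> rval e1 s < rval e2 s"
| "bval (BNot b) s \<longleftrightarrow> \<not> bval b s"
| "bval (BAnd b1 b2) s \<longleftrightarrow> bval b1 s \<and> bval b2 s"

definition tick :: "state \<Rightarrow> state" where
  "tick s = s\<lparr>clock := Suc (clock s)\<rparr>"

definition set_nvar :: "nat \<Rightarrow> nat \<Rightarrow> state \<Rightarrow> state" where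
  "set_nvar x v s = s\<lparr>nvar := (nvar s)(x := v)\<rparr>"

definition set_narr :: "nat \<Rightarrow> nat \<Rightarrow> nat \<Rightarrow> state \<Rightarrow> state" where
  "set_narr a i v s = s\<lparr>narr := (narr s)(a := (narr s a)(i := v))\<rparr>"

definition set_rvar :: "nat \<Rightarrow> real \<Rightarrow> state \<Rightarrow> state" where
  "set_rvar x v s = s\<lparr>rvar := (rvar s)(x := v)\<rparr>"

definition set_rarr :: "nat \<Rightarrow> nat \<Rightarrow> real \<Rightarrow> state \<Rightarrow> state" where
  "set_rarr a i v s = s\<lparr>rarr := (rarr s)(a := (rarr s a)(i := v))\<rparr>"

definition emit :: "nat \<Rightarrow> state \<Rightarrow> state" where
  "emit v s = s\<lparr>emitted := emitted s @ [v]\<rparr>"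

text \<open>A missing value of the subprobability distribution stands for divergence.\<close>

partial_function (spmf) while_spmf ::
  "(state \<Rightarrow> bool) \<Rightarrow> (state \<Rightarrow> state spmf) \<Rightarrow> state \<Rightarrow> state spmf" where
  "while_spmf b c s =
     (if b s then bind_spmf (c (tick s)) (\<lambda>s'. while_spmf b c s') else return_spmf (tick s))"

text \<open>
  \<^const>\<open>Uniform\<close> draws a uniform index below the given bound (0 if the bound is 0).
  \<^const>\<open>Flip\<close> sets a scalar to 1 if a fresh uniform deviate from the unit interval falls
  below the given real value and to 0 otherwise; \<^const>\<open>bernoulli_pmf\<close> clamps its argument
  to the unit interval.
\<close>

primrec exec :: "com \<Rightarrow> state \<Rightarrow> state spmf" where
  "exec Skip = (\<lambda>s. return_spmf (tick s))"
| "exec (NAssign x e) = (\<lambda>s. return_spmf (tick (set_nvar x (nval e s) s)))"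
| "exec (NStore a i e) = (\<lambda>s. return_spmf (tick (set_narr a (nval i s) (nval e s) s)))"
| "exec (RAssign x e) = (\<lambda>s. return_spmf (tick (set_rvar x (rval e s) s)))"
| "exec (RStore a i e) = (\<lambda>s. return_spmf (tick (set_rarr a (nval i s) (rval e s) s)))"
| "exec (Uniform x e) = (\<lambda>s. spmf_of_pmf (map_pmf (\<lambda>v. tick (set_nvar x v s))
     (if nval e s = 0 then return_pmf 0 else pmf_of_set {..<nval e s})))"
| "exec (Flip x e) = (\<lambda>s. spmf_of_pmf (map_pmf (\<lambda>h. tick (set_nvar x (if h then 1 else 0) s))
     (bernoulli_pmf (rval e s))))"
| "exec (Emit e) = (\<lambda>s. return_spmf (tick (emit (nval e s) s)))"
| "exec (Seq c1 c2) = (\<lambda>s. bind_spmf (exec c1 s) (exec c2))"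
| "exec (If b c1 c2) = (\<lambda>s. if bval b s then exec c1 (tick s) else exec c2 (tick s))"
| "exec (While b c) = while_spmf (bval b) (exec c)"

text \<open>
  Input convention: scalar 0 holds the number of local items, natural array 0 their global
  identifiers and real array 0 their inclusion probabilities; all other cells are zero.
\<close>

definition initial_state :: "(nat \<Rightarrow> real) \<Rightarrow> nat list \<Rightarrow> state" where
  "initial_state w xs =
    \<lparr>nvar = (\<lambda>_. 0)(0 := length xs),
     narr = (\<lambda>_ _. 0)(0 := (\<lambda>j. if j < length xs then xs ! j else 0)),
     rvar = (\<lambda>_. 0),
     rarr = (\<lambda>_ _. 0)(0 := (\<lambda>j. if j < length xs then w (xs ! j) else 0)),
     emitted = [], clock = 0\<rparr>"

text \<open>
  After one preprocessing run, the sampling program is invoked \<open>k\<close> times, each time on the memory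
  left by the previous call. Asking for several independent samples from one preprocessing rules
  out drawing the sample already during preprocessing. The result records the preprocessing time
  and the output and time of each call.
\<close>

primrec rounds :: "com \<Rightarrow> nat \<Rightarrow> state \<Rightarrow> (nat list \<times> nat) list spmf" where
  "rounds samp 0 s = return_spmf []"
| "rounds samp (Suc k) s =
     bind_spmf (exec samp (s\<lparr>emitted := [], clock := 0\<rparr>))
       (\<lambda>s'. map_spmf (\<lambda>rs. (emitted s', clock s') # rs) (rounds samp k s'))"

type_synonym pe_result = "nat \<times> (nat list \<times> nat) list"

definition run_pe :: "com \<Rightarrow> com \<Rightarrow> nat \<Rightarrow> (nat \<Rightarrow> real) \<Rightarrow> nat list \<Rightarrow> pe_result spmf" where
  "run_pe prep samp k w xs =
     bind_spmf (exec prep (initial_state w xs))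
       (\<lambda>s. map_spmf (\<lambda>rs. (clock s, rs)) (rounds samp k s))"

text \<open>Independent runs of \<open>p\<close> PEs; the joint run diverges as soon as one PE does.\<close>

definition parallel :: "nat \<Rightarrow> (nat \<Rightarrow> 'a spmf) \<Rightarrow> (nat \<Rightarrow> 'a) spmf" where
  "parallel p R =
     map_pmf (\<lambda>x. if \<forall>q<p. x q \<noteq> None then Some (\<lambda>q. the (x q)) else None)
       (Pi_pmf {..<p} None R)"

text \<open>Items are \<open>0, \<dots>, n - 1\<close>; the placement \<open>f\<close> maps each item to its PE.\<close>

definition local_items :: "nat \<Rightarrow> (nat \<Rightarrow> nat) \<Rightarrow> nat \<Rightarrow> nat list" where
  "local_items n f q = filter (\<lambda>i. f i = q) [0..<n]"

definition run_machine ::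
  "com \<Rightarrow> com \<Rightarrow> nat \<Rightarrow> nat \<Rightarrow> (nat \<Rightarrow> real) \<Rightarrow> nat \<Rightarrow> (nat \<Rightarrow> nat) \<Rightarrow> (nat \<Rightarrow> pe_result) spmf" where
  "run_machine prep samp k n w p f =
     parallel p (\<lambda>q. run_pe prep samp k w (local_items n f q))"

definition round_output :: "nat \<Rightarrow> pe_result \<Rightarrow> nat list" where
  "round_output r x = fst (snd x ! r)"

definition sample :: "nat \<Rightarrow> nat \<Rightarrow> (nat \<Rightarrow> pe_result) \<Rightarrow> nat set" where
  "sample p r x = (\<Union>q<p. set (round_output r (x q)))"

definition prep_time :: "nat \<Rightarrow> (nat \<Rightarrow> pe_result) \<Rightarrow> nat" where
  "prep_time p x = Max ((\<lambda>q. fst (x q)) ` {..<p})"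

definition sampling_time :: "nat \<Rightarrow> nat \<Rightarrow> (nat \<Rightarrow> pe_result) \<Rightarrow> nat" where
  "sampling_time p r x = Max ((\<lambda>q. snd (snd (x q) ! r)) ` {..<p})"

definition expected_time :: "('a \<Rightarrow> nat) \<Rightarrow> 'a spmf \<Rightarrow> ennreal" where
  "expected_time T M =
     (\<integral>\<^sup>+ x. (case x of None \<Rightarrow> \<infinity> | Some y \<Rightarrow> of_nat (T y)) \<partial>measure_pmf M)"

definition random_placement :: "nat \<Rightarrow> nat \<Rightarrow> (nat \<Rightarrow> nat) pmf" where
  "random_placement n p = Pi_pmf {..<n} 0 (\<lambda>_. pmf_of_set {..<p})"

definition random_run ::
  "com \<Rightarrow> com \<Rightarrow> nat \<Rightarrow> nat \<Rightarrow> (nat \<Rightarrow> real) \<Rightarrow> nat \<Rightarrow> (nat \<Rightarrow> pe_result) spmf" where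
  "random_run prep samp k n w p =
     bind_pmf (random_placement n p) (run_machine prep samp k n w p)"

definition subset_pmf :: "nat \<Rightarrow> (nat \<Rightarrow> real) \<Rightarrow> nat set pmf" where
  "subset_pmf n w =
     map_pmf (\<lambda>x. {i. i < n \<and> x i}) (Pi_pmf {..<n} False (\<lambda>i. bernoulli_pmf (w i)))"

text \<open>
  Correctness is required for every placement: almost surely every PE reports only own items, each at
  most once, and the samples of successive calls are independent with the required distribution
  (in particular the machine terminates almost surely).
\<close>

definition weighted_subset_sampler ::
  "com \<Rightarrow> com \<Rightarrow> nat \<Rightarrow> (nat \<Rightarrow> real) \<Rightarrow> nat \<Rightarrow> bool" where
  "weighted_subset_sampler prep samp n w p \<longleftrightarrow>
     (\<forall>f k. (\<forall>i<n. f i < p) \<longrightarrow>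
        map_spmf (\<lambda>x. map (\<lambda>r. sample p r x) [0..<k]) (run_machine prep samp k n w p f)
          = spmf_of_pmf (replicate_pmf k (subset_pmf n w))
        \<and> (\<forall>x\<in>set_spmf (run_machine prep samp k n w p f). \<forall>r<k. \<forall>q<p.
              distinct (round_output r (x q))
              \<and> set (round_output r (x q)) \<subseteq> set (local_items n f q)))"

end

theory Submission
  imports Defs
begin

text \<open>
  An item of probability at most \<open>1/2\<close> is hit by a Poisson process of rate \<open>- ln (1 - w i)\<close> with
  probability \<open>w i\<close>. Each PE draws the total number of points by inverting the Poisson law step by
  step and throws the points uniformly into a table of \<open>O(m)\<close> cells for its \<open>m\<close> items; the cells are
  cut such that one further coin per point corrects the rates. The remaining items, at most twice
  their total weight in number, are flipped one by one. The probability that the reported items all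
  lie in a set \<open>A\<close> is the product of \<open>1 - w i\<close> over \<open>i \<notin> A\<close>, and these probabilities determine the law.
  The running times have exponential moments that are exponential in the local load, and the load is
  a sum of independent variables over the items; a union bound over the PEs costs the \<open>log p\<close>.
\<close>

section \<open>Almost sure termination and expectations of programs\<close>

text \<open>The cell rate \<open>u\<close> must serve two ends: a small \<open>u\<close> makes the
  table long, a large one makes many points be thrown in vain. For the mean weight
  \<open>u > 0\<close> of \<open>m\<close> items of total weight \<open>W\<close>, an item of
  probability at most 1/2 needs at most \<open>rate (w i) / u + 1\<close> cells. That gives at most
  \<open>2 * W / u + m = 3 * m\<close> cells, and a Poisson mean (cells times \<open>u\<close>) of
  at most \<open>3 * W\<close>. The threshold 1/2 is there because \<open>rate x\<close> is
  unbounded near 1 but at most \<open>2 * x\<close> up to 1/2. As reals cannot be rounded to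
  indices, pieces are cut by repeated subtraction and the Poisson number is found by stepwise
  search. Several points may hit one item. Stamping items with the number of the call suppresses
  repetitions without clearing an array of length \<open>m\<close>, which would exceed the sampling
  time. Downset events suit this: a repeated report does not change them, and their probabilities
  factor over points, phases, calls and PEs. The Poisson search is the only loop without a bound on
  its iterations. Its law and its termination both come from lower bounds on point masses that
  already add up to 1.\<close>

definition sure :: "'a spmf \<Rightarrow> ('a \<Rightarrow> bool) \<Rightarrow> bool" where
  "sure p Q \<longleftrightarrow> (\<forall>r\<in>set_pmf p. case r of None \<Rightarrow> False | Some x \<Rightarrow> Q x)"

text \<open>Divergence counts 0 here but infinity in \<open>expected_time\<close>. With 0, the
  expectation of an indicator is the probability of terminating in the event;
  \<open>expect_top_conv\<close> reconciles the two conventions for almost surely terminating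
  programs.\<close>

definition expect :: "'a spmf \<Rightarrow> ('a \<Rightarrow> ennreal) \<Rightarrow> ennreal" where
  "expect p \<phi> = (\<integral>\<^sup>+ r. (case r of None \<Rightarrow> 0 | Some x \<Rightarrow> \<phi> x) \<partial>measure_pmf p)"

lemma sure_return [simp]: "sure (return_spmf x) Q \<longleftrightarrow> Q x"
  by (simp add: sure_def)

lemma sure_bind [simp]: "sure (bind_spmf p f) Q \<longleftrightarrow> sure p (\<lambda>x. sure (f x) Q)"
  by (fastforce simp: sure_def bind_spmf_def split: option.splits)

lemma sure_map [simp]: "sure (map_spmf g p) Q \<longleftrightarrow> sure p (\<lambda>x. Q (g x))"
  by (fastforce simp: sure_def split: option.splits)

lemma sure_spmf_of_pmf [simp]: "sure (spmf_of_pmf p) Q \<longleftrightarrow> (\<forall>x\<in>set_pmf p. Q x)"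
  by (auto simp: sure_def spmf_of_pmf_def)

lemma sure_mono: "sure p Q \<Longrightarrow> (\<And>x. Q x \<Longrightarrow> R x) \<Longrightarrow> sure p R"
  by (fastforce simp: sure_def split: option.splits)

lemma sure_set_spmf: "sure p Q \<Longrightarrow> x \<in> set_spmf p \<Longrightarrow> Q x"
  by (fastforce simp: sure_def in_set_spmf split: option.splits)

lemma expect_return [simp]: "expect (return_spmf x) \<phi> = \<phi> x"
  by (simp add: expect_def)

lemma expect_bind [simp]: "expect (bind_spmf p f) \<phi> = expect p (\<lambda>x. expect (f x) \<phi>)"
  unfolding expect_def bind_spmf_def nn_integral_bind_pmf
  by (intro nn_integral_cong) (simp split: option.splits)

lemma expect_map [simp]: "expect (map_spmf g p) \<phi> = expect p (\<lambda>x. \<phi> (g x))"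
  unfolding expect_def nn_integral_map_pmf
  by (intro nn_integral_cong) (simp split: option.splits)

lemma expect_spmf_of_pmf [simp]: "expect (spmf_of_pmf p) \<phi> = (\<integral>\<^sup>+ x. \<phi> x \<partial>measure_pmf p)"
  by (simp add: expect_def spmf_of_pmf_def)

lemma expect_mono:
  assumes "sure p Q" "\<And>x. Q x \<Longrightarrow> \<phi> x \<le> \<psi> x"
  shows "expect p \<phi> \<le> expect p \<psi>"
  unfolding expect_def using assms
  by (intro nn_integral_mono_AE) (fastforce simp: AE_measure_pmf_iff sure_def split: option.splits)

lemma expect_cong:
  assumes "sure p Q" "\<And>x. Q x \<Longrightarrow> \<phi> x = \<psi> x"
  shows "expect p \<phi> = expect p \<psi>"
  by (intro antisym expect_mono[OF assms(1)]) (simp_all add: assms(2))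

lemma expect_mono': "(\<And>x. \<phi> x \<le> \<psi> x) \<Longrightarrow> expect p \<phi> \<le> expect p \<psi>"
  unfolding expect_def by (intro nn_integral_mono) (simp split: option.splits)

lemma expect_cmult: "expect p (\<lambda>x. c * \<phi> x) = c * expect p \<phi>"
  unfolding expect_def by (subst nn_integral_cmult[symmetric]) (auto intro!: nn_integral_cong split: option.splits)

lemma expect_multc: "expect p (\<lambda>x. \<phi> x * c) = expect p \<phi> * c"
  using expect_cmult[of p c \<phi>] by (simp add: mult.commute)

lemma expect_add: "expect p (\<lambda>x. \<phi> x + \<psi> x) = expect p \<phi> + expect p \<psi>"
  unfolding expect_def by (subst nn_integral_add[symmetric]) (auto intro!: nn_integral_cong split: option.splits)

lemma expect_sum: "expect p (\<lambda>x. \<Sum>i\<in>I. \<phi> i x) = (\<Sum>i\<in>I. expect p (\<phi> i))"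
  unfolding expect_def by (subst nn_integral_sum[symmetric]) (auto intro!: nn_integral_cong split: option.splits)

lemma expect_const: "sure p Q \<Longrightarrow> expect p (\<lambda>_. c) = c"
proof -
  assume s: "sure p Q"
  have "expect p (\<lambda>_. c) = (\<integral>\<^sup>+ r. c \<partial>measure_pmf p)"
    unfolding expect_def using s
    by (intro nn_integral_cong_AE) (auto simp: AE_measure_pmf_iff sure_def split: option.splits)
  then show ?thesis by simp
qed

lemma expect_le:
  assumes "sure p Q" "\<And>x. Q x \<Longrightarrow> \<phi> x \<le> c"
  shows "expect p \<phi> \<le> c"
  using expect_mono[OF assms] expect_const[OF assms(1)] by simp

lemma expect_top_conv:
  assumes "sure p Q"
  shows "(\<integral>\<^sup>+ r. (case r of None \<Rightarrow> \<infinity> | Some x \<Rightarrow> \<phi> x) \<partial>measure_pmf p) = expect p \<phi>"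
  unfolding expect_def using assms
  by (intro nn_integral_cong_AE) (auto simp: AE_measure_pmf_iff sure_def split: option.splits)

lemma select_simps [simp]:
  "nvar (tick s) = nvar s" "narr (tick s) = narr s" "rvar (tick s) = rvar s"
  "rarr (tick s) = rarr s" "emitted (tick s) = emitted s" "clock (tick s) = Suc (clock s)"
  "nvar (set_nvar x v s) = (nvar s)(x := v)" "narr (set_nvar x v s) = narr s"
  "rvar (set_nvar x v s) = rvar s" "rarr (set_nvar x v s) = rarr s"
  "emitted (set_nvar x v s) = emitted s" "clock (set_nvar x v s) = clock s"
  "nvar (set_narr a i v s) = nvar s" "narr (set_narr a i v s) = (narr s)(a := (narr s a)(i := v))"
  "rvar (set_narr a i v s) = rvar s" "rarr (set_narr a i v s) = rarr s"
  "emitted (set_narr a i v s) = emitted s" "clock (set_narr a i v s) = clock s"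
  "nvar (set_rvar x y s) = nvar s" "narr (set_rvar x y s) = narr s"
  "rvar (set_rvar x y s) = (rvar s)(x := y)" "rarr (set_rvar x y s) = rarr s"
  "emitted (set_rvar x y s) = emitted s" "clock (set_rvar x y s) = clock s"
  "nvar (set_rarr a i y s) = nvar s" "narr (set_rarr a i y s) = narr s"
  "rvar (set_rarr a i y s) = rvar s" "rarr (set_rarr a i y s) = (rarr s)(a := (rarr s a)(i := y))"
  "emitted (set_rarr a i y s) = emitted s" "clock (set_rarr a i y s) = clock s"
  "nvar (emit v s) = nvar s" "narr (emit v s) = narr s"
  "rvar (emit v s) = rvar s" "rarr (emit v s) = rarr s"
  "emitted (emit v s) = emitted s @ [v]" "clock (emit v s) = clock s"
  by (simp_all add: tick_def set_nvar_def set_narr_def set_rvar_def set_rarr_def emit_def)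

section \<open>Rules for random instructions and loops\<close>

declare exec.simps(11) [simp del]

lemma exec_While:
  "exec (While b c) s =
    (if bval b s then bind_spmf (exec c (tick s)) (exec (While b c)) else return_spmf (tick s))"
  unfolding exec.simps(11) by (subst while_spmf.simps) (simp add: exec.simps(11))

lemma sure_exec_Uniform:
  assumes "0 < nval e s"
  shows "sure (exec (Uniform x e) s) Q \<longleftrightarrow> (\<forall>v<nval e s. Q (tick (set_nvar x v s)))"
  using assms by (subst exec.simps, subst sure_spmf_of_pmf) (auto simp: set_pmf_of_set lessThan_empty_iff)

lemma expect_exec_Uniform:
  assumes "0 < nval e s"
  shows "expect (exec (Uniform x e) s) \<phi> = (\<Sum>v<nval e s. \<phi> (tick (set_nvar x v s))) / of_nat (nval e s)"
  using assms by (subst exec.simps, subst expect_spmf_of_pmf)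
    (simp add: nn_integral_pmf_of_set lessThan_empty_iff ennreal_of_nat_eq_real_of_nat)

lemma sure_exec_Flip:
  "Q (tick (set_nvar x 0 s)) \<Longrightarrow> Q (tick (set_nvar x 1 s)) \<Longrightarrow> sure (exec (Flip x e) s) Q"
  by (subst exec.simps, subst sure_spmf_of_pmf) auto

lemma expect_exec_Flip:
  assumes "0 \<le> rval e s" "rval e s \<le> 1"
  shows "expect (exec (Flip x e) s) \<phi> = \<phi> (tick (set_nvar x 1 s)) * ennreal (rval e s)
    + \<phi> (tick (set_nvar x 0 s)) * ennreal (1 - rval e s)"
  by (subst exec.simps, subst expect_spmf_of_pmf) (simp add: assms)

declare exec.simps(6,7) [simp del]

text \<open>The measure drops in every outcome of the body, so the number of iterations is bounded
  outright. This serves all loops except the Poisson search.\<close>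

lemma sure_While:
  fixes m :: "state \<Rightarrow> nat"
  assumes "I s"
    and "\<And>s. I s \<Longrightarrow> bval b s \<Longrightarrow> sure (exec c (tick s)) (\<lambda>s'. I s' \<and> m s' < m s)"
    and "\<And>s. I s \<Longrightarrow> \<not> bval b s \<Longrightarrow> Q (tick s)"
  shows "sure (exec (While b c) s) Q"
  using assms(1)
proof (induction "m s" arbitrary: s rule: less_induct)
  case less
  show ?case
  proof (cases "bval b s")
    case True
    have "sure (exec c (tick s)) (\<lambda>s'. sure (exec (While b c) s') Q)"
      by (rule sure_mono[OF assms(2)[OF less.prems True]]) (use less.hyps in blast)
    then show ?thesis by (subst exec_While) (simp add: True)
  qed (subst exec_While, simp add: assms(3) less.prems)
qed

text \<open>\<open>g\<close> is a martingale along the iterations. Because the measure bounds their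
  number, stopping needs no integrability argument and the expectation is exact, as equality of laws
  demands.\<close>

lemma expect_While:
  fixes m :: "state \<Rightarrow> nat"
  assumes "I s"
    and "\<And>s. I s \<Longrightarrow> bval b s \<Longrightarrow> sure (exec c (tick s)) (\<lambda>s'. I s' \<and> m s' < m s)"
    and "\<And>s. I s \<Longrightarrow> bval b s \<Longrightarrow> expect (exec c (tick s)) g = g s"
    and "\<And>s. I s \<Longrightarrow> \<not> bval b s \<Longrightarrow> \<phi> (tick s) = g s"
  shows "expect (exec (While b c) s) \<phi> = g s"
  using assms(1)
proof (induction "m s" arbitrary: s rule: less_induct)
  case less
  show ?case
  proof (cases "bval b s")
    case True
    have "expect (exec c (tick s)) (\<lambda>s'. expect (exec (While b c) s') \<phi>) = expect (exec c (tick s)) g"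
      by (rule expect_cong[OF assms(2)[OF less.prems True]]) (use less.hyps in blast)
    then show ?thesis using assms(3)[OF less.prems True] by (subst exec_While) (simp add: True)
  qed (subst exec_While, simp add: assms(4) less.prems)
qed

section \<open>A law on finite sets is determined by its downset probabilities\<close>

text \<open>Moebius inversion as an induction: the point mass of \<open>A\<close> is its downset
  probability minus the masses of its proper subsets, which agree by hypothesis of the
  induction.\<close>

lemma pmf_eqI_subset_prob:
  fixes P Q :: "'b set pmf"
  assumes U: "finite U" and P: "set_pmf P \<subseteq> Pow U" and Q: "set_pmf Q \<subseteq> Pow U"
    and eq: "\<And>A. A \<subseteq> U \<Longrightarrow> measure_pmf.prob P {B. B \<subseteq> A} = measure_pmf.prob Q {B. B \<subseteq> A}"
  shows "P = Q"
proof (rule pmf_eqI)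
  fix A
  show "pmf P A = pmf Q A"
  proof (cases "A \<subseteq> U")
    case True
    then have "finite A" using U finite_subset by blast
    then show ?thesis using True
    proof (induction A rule: finite_psubset_induct)
      case (psubset A)
      have split: "measure_pmf.prob M {B. B \<subseteq> A} = pmf M A + (\<Sum>B\<in>{B. B \<subset> A}. pmf M B)" for M :: "'b set pmf"
      proof -
        have e: "{B. B \<subseteq> A} = insert A {B. B \<subset> A}" by auto
        have f: "finite {B. B \<subset> A}"
          using psubset.hyps by (rule_tac finite_subset[of _ "Pow A"]) auto
        show ?thesis using f by (simp add: e measure_measure_pmf_finite)
      qed
      have "(\<Sum>B\<in>{B. B \<subset> A}. pmf P B) = (\<Sum>B\<in>{B. B \<subset> A}. pmf Q B)"
        using psubset by (intro sum.cong) auto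
      then show ?case using split[of P] split[of Q] eq[OF psubset.prems] by simp
    qed
  next
    case False
    then show ?thesis using P Q by (metis PowD set_pmf_iff subsetD)
  qed
qed

section \<open>Poisson numbers by sequential inversion\<close>

text \<open>Rate 0 belongs to a PE with an empty table; the point mass at 0 continues the Poisson
  formula there, with \<open>0 ^ 0 = 1\<close>.\<close>

definition pois :: "real \<Rightarrow> nat pmf" where
  "pois \<mu> = (if \<mu> = 0 then return_pmf 0 else poisson_pmf \<mu>)"

lemma pmf_pois: "0 \<le> \<mu> \<Longrightarrow> pmf (pois \<mu>) k = \<mu> ^ k / fact k * exp (- \<mu>)"
  by (cases k) (auto simp: pois_def)

text \<open>The generating function, by tilting: \<open>z ^ k\<close> times the mass for rate
  \<open>\<mu>\<close> is \<open>exp (\<mu> * (z - 1))\<close> times the mass for rate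
  \<open>\<mu> * z\<close>. It is applied with \<open>z\<close> a rejection probability for
  correctness and with \<open>z = exp 14\<close> for the running time.\<close>

lemma nn_integral_pois_power:
  assumes "0 \<le> \<mu>" "0 \<le> z"
  shows "(\<integral>\<^sup>+ k. ennreal (z ^ k) \<partial>measure_pmf (pois \<mu>)) = ennreal (exp (\<mu> * (z - 1)))"
proof -
  have "(\<integral>\<^sup>+ k. ennreal (z ^ k) \<partial>measure_pmf (pois \<mu>))
      = (\<integral>\<^sup>+ k. ennreal (exp (\<mu> * (z - 1))) * ennreal (pmf (pois (\<mu> * z)) k) \<partial>count_space UNIV)"
    unfolding nn_integral_measure_pmf
    by (intro nn_integral_cong)
      (simp add: assms pmf_pois power_mult_distrib algebra_simps flip: ennreal_mult exp_add)
  also have "\<dots> = ennreal (exp (\<mu> * (z - 1)))"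
    by (subst nn_integral_cmult) (simp_all add: nn_integral_pmf)
  finally show ?thesis .
qed

section \<open>Exact laws from lower bounds on point masses\<close>

lemma expect_of_bool_eq: "expect p (\<lambda>y. of_bool (y = x)) = ennreal (spmf p x)"
proof -
  have "expect p (\<lambda>y. of_bool (y = x)) = (\<integral>\<^sup>+ r. indicator {Some x} r \<partial>measure_pmf p)"
    unfolding expect_def by (intro nn_integral_cong) (auto split: option.splits)
  then show ?thesis by (simp add: emeasure_pmf_single)
qed

text \<open>The masses of \<open>P\<close> add up to 1. Outside any \<open>r\<close>,
  \<open>D\<close> has at least the mass of \<open>P\<close>, which leaves at most
  \<open>pmf P r\<close> for \<open>r\<close>; for \<open>r = None\<close> this excludes
  divergence.\<close>

lemma spmf_eqI_le:
  assumes "\<And>x. pmf P x \<le> spmf D x"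
  shows "D = spmf_of_pmf P"
proof (rule pmf_eqI)
  fix r
  have le: "pmf (spmf_of_pmf P) r \<le> pmf D r" for r
    using assms by (cases r) simp_all
  have "emeasure (measure_pmf (spmf_of_pmf P)) (- {r}) \<le> emeasure (measure_pmf D) (- {r})"
    unfolding nn_integral_pmf[symmetric] by (intro nn_integral_mono) (simp add: le)
  then have "measure_pmf.prob (spmf_of_pmf P) (- {r}) \<le> measure_pmf.prob D (- {r})"
    by (simp add: measure_pmf.emeasure_eq_measure)
  then show "pmf D r = pmf (spmf_of_pmf P) r"
    using le[of r] by (simp add: measure_pmf.prob_compl[of "{r}", simplified] Compl_eq_Diff_UNIV measure_pmf_single)
qed

text \<open>Finite unrollings of a loop only bound probabilities from below. Applied to the pair of
  \<open>X s\<close> and the truth value of \<open>Q s\<close>, such bounds with total mass 1 give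
  the exact law of \<open>X\<close>, termination, and \<open>Q\<close> almost surely.\<close>

lemma law_from_lower_bound:
  fixes X :: "'a \<Rightarrow> nat"
  assumes "\<And>k. ennreal (pmf P k) \<le> expect D (\<lambda>s. of_bool (X s = k \<and> Q s))"
  shows sure_from_lower_bound: "sure D (\<lambda>s. Q s \<and> X s \<in> set_pmf P)"
    and expect_from_lower_bound: "expect D (\<lambda>s. h (X s)) = (\<integral>\<^sup>+ k. h k \<partial>measure_pmf P)"
proof -
  have D: "map_spmf (\<lambda>s. (X s, Q s)) D = spmf_of_pmf (map_pmf (\<lambda>k. (k, True)) P)"
  proof (rule spmf_eqI_le)
    fix x :: "nat \<times> bool"
    obtain k b where x: "x = (k, b)" by (cases x)
    have i: "inj (\<lambda>k::nat. (k, True))" by (rule injI) simp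
    have "ennreal (pmf (map_pmf (\<lambda>k. (k, True)) P) x) \<le> expect (map_spmf (\<lambda>s. (X s, Q s)) D) (\<lambda>y. of_bool (y = x))"
    proof (cases b)
      case True
      then show ?thesis using assms[of k] pmf_map_inj'[OF i, of P k] by (simp add: x)
    next
      case False
      then have "pmf (map_pmf (\<lambda>k. (k, True)) P) x = 0" by (auto simp: x pmf_eq_0_set_pmf)
      then show ?thesis by simp
    qed
    then show "pmf (map_pmf (\<lambda>k. (k, True)) P) x \<le> spmf (map_spmf (\<lambda>s. (X s, Q s)) D) x"
      by (subst (asm) expect_of_bool_eq) simp
  qed
  have "sure (map_spmf (\<lambda>s. (X s, Q s)) D) (\<lambda>x. snd x \<and> fst x \<in> set_pmf P)" by (subst D) simp
  then show "sure D (\<lambda>s. Q s \<and> X s \<in> set_pmf P)" by simp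
  have "expect (map_spmf (\<lambda>s. (X s, Q s)) D) (\<lambda>x. h (fst x)) = (\<integral>\<^sup>+ k. h k \<partial>measure_pmf P)" by (subst D) simp
  then show "expect D (\<lambda>s. h (X s)) = (\<integral>\<^sup>+ k. h k \<partial>measure_pmf P)" by simp
qed

text \<open>
  Scalar 2 holds the probability of the current value and scalar 3 that of the current value or
  a larger one, so that their quotient is the hazard rate of the Poisson law.
\<close>

definition poisson_loop :: com where
  "poisson_loop =
    While (NLess (NVar 5) (NConst 1))
      (Seq (Flip 5 (RDiv (RVar 2) (RVar 3)))
        (If (NLess (NVar 5) (NConst 1))
          (Seq (RAssign 3 (RSub (RVar 3) (RVar 2)))
            (Seq (NAssign 6 (NAdd (NVar 6) (NConst 1)))
              (RAssign 2 (RDiv (RMul (RVar 2) (RVar 0)) (RNat (NVar 6))))))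
          Skip))"

definition poisson_prog :: com where
  "poisson_prog =
    Seq (NAssign 5 (NConst 0)) (Seq (NAssign 6 (NConst 0))
      (Seq (RAssign 2 (RExp (RSub (RNat (NConst 0)) (RVar 0)))) (Seq (RAssign 3 (RNat (NConst 1)))
        poisson_loop)))"

definition same_data :: "state \<Rightarrow> state \<Rightarrow> bool" where
  "same_data s0 s \<longleftrightarrow> narr s = narr s0 \<and> rarr s = rarr s0 \<and> emitted s = emitted s0
    \<and> nvar s 0 = nvar s0 0 \<and> nvar s 1 = nvar s0 1 \<and> nvar s 2 = nvar s0 2 \<and> nvar s 3 = nvar s0 3
    \<and> rvar s 0 = rvar s0 0 \<and> rvar s 1 = rvar s0 1"

definition pois_tail :: "real \<Rightarrow> nat \<Rightarrow> real" where
  "pois_tail \<mu> k = 1 - (\<Sum>j<k. pmf (pois \<mu>) j)"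

lemma pmf_le_pois_tail: "pmf (pois \<mu>) k \<le> pois_tail \<mu> k"
proof -
  have "(\<Sum>j<Suc k. pmf (pois \<mu>) j) \<le> 1"
    by (simp add: measure_measure_pmf_finite[symmetric] del: sum.lessThan_Suc)
  then show ?thesis by (simp add: pois_tail_def)
qed

text \<open>The left side is the probability of the value \<open>k + d\<close> given that it is at
  least \<open>k\<close>. Only the path with \<open>d\<close> rejections is followed, and its hazard
  factors telescope: \<open>1 - p k / t k\<close> equals \<open>t (k + 1) / t k\<close> for masses
  \<open>p\<close> and tails \<open>t\<close>. A rejected value costs 6 units, the accepting pass
  and the loop exit 5.\<close>

lemma poisson_loop_lower_bound:
  assumes "0 \<le> rvar s0 0"
    and "rvar s 2 = pmf (pois (rvar s0 0)) k" "rvar s 3 = pois_tail (rvar s0 0) k"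
    and "nvar s 5 = 0" "nvar s 6 = k" "same_data s0 s" "clock s \<le> a + 6 * k"
    and "0 < pois_tail (rvar s0 0) k"
  shows "ennreal (pmf (pois (rvar s0 0)) (k + d) / pois_tail (rvar s0 0) k)
    \<le> expect (exec poisson_loop s)
        (\<lambda>s'. of_bool (nvar s' 6 = k + d \<and> same_data s0 s' \<and> clock s' \<le> a + 6 * nvar s' 6 + 5))"
  using assms(2-)
proof (induction d arbitrary: s k)
  case 0
  let ?p = "pmf (pois (rvar s0 0))" and ?t = "pois_tail (rvar s0 0)"
  have fl: "0 \<le> ?p k / ?t k" "?p k / ?t k \<le> 1"
    using 0 pmf_le_pois_tail[of "rvar s0 0" k] by (simp_all add: divide_simps)
  show ?case
    unfolding poisson_loop_def
    apply (subst exec_While)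
    apply (simp add: 0)
    apply (subst expect_exec_Flip)
    using fl 0 apply (simp, simp)
    apply (simp add: 0)
    apply (subst exec_While)
    using 0 apply (simp add: same_data_def)
    done
next
  case (Suc d)
  let ?p = "pmf (pois (rvar s0 0))" and ?t = "pois_tail (rvar s0 0)"
  have fl: "0 \<le> ?p k / ?t k" "?p k / ?t k \<le> 1"
    using Suc.prems pmf_le_pois_tail[of "rvar s0 0" k] by (simp_all add: divide_simps)
  have tS: "?t (Suc k) = ?t k - ?p k" by (simp add: pois_tail_def)
  have pS: "?p (Suc k) = ?p k * rvar s0 0 / real (Suc k)"
    using assms(1) by (simp add: pmf_pois field_simps)
  show ?case
  \<comment> \<open>A vanishing tail, as for rate 0, gives the induction hypothesis nothing to
    condition on; the target mass is then 0 as well.\<close>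
  proof (cases "?t (Suc k) = 0")
    case True
    have "?p (k + Suc d) \<le> 0"
    proof -
      have "(\<Sum>j<Suc k. ?p j) + ?p (k + Suc d) \<le> (\<Sum>j\<in>insert (k + Suc d) {..<Suc k}. ?p j)"
        by (subst sum.insert) auto
      also have "\<dots> \<le> 1" by (subst measure_measure_pmf_finite[symmetric]) auto
      finally show ?thesis using True by (simp add: pois_tail_def)
    qed
    then have "?p (k + Suc d) = 0" using pmf_nonneg[of _ "k + Suc d"] by (meson antisym)
    then show ?thesis by simp
  next
    case False
    then have t: "0 < ?t (Suc k)" using pmf_le_pois_tail[of "rvar s0 0" "Suc k"] pmf_nonneg[of "pois (rvar s0 0)" "Suc k"]
      by linarith
    define s1 where "s1 = tick (set_nvar 5 0 (tick s))"
    define s2 where "s2 = tick (set_rvar 3 (?t (Suc k)) (tick s1))"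
    define s3 where "s3 = tick (set_nvar 6 (Suc k) s2)"
    define s4 where "s4 = tick (set_rvar 2 (?p (Suc k)) s3)"
    let ?\<phi> = "\<lambda>s'. of_bool (nvar s' 6 = k + Suc d \<and> same_data s0 s' \<and> clock s' \<le> a + 6 * nvar s' 6 + 5) :: ennreal"
    have "ennreal (?p (k + Suc d) / ?t (Suc k)) \<le> expect (exec poisson_loop s4) ?\<phi>"
      using Suc.prems t Suc.IH[of s4 "Suc k"]
      by (simp add: s1_def s2_def s3_def s4_def same_data_def)
    then have "ennreal (?p (k + Suc d) / ?t (Suc k)) * ennreal (1 - ?p k / ?t k)
        \<le> expect (exec poisson_loop s4) ?\<phi> * ennreal (1 - ?p k / ?t k)"
      by (rule mult_right_mono) simp
    also have "\<dots> \<le> expect (exec poisson_loop s) ?\<phi>"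
      unfolding poisson_loop_def
      apply (subst (2) exec_While)
      apply (simp add: Suc.prems)
      apply (subst expect_exec_Flip)
      using fl Suc.prems apply (simp, simp)
      using pS tS Suc.prems apply (simp add: s1_def s2_def s3_def s4_def same_data_def)
      done
    finally show ?thesis
      using Suc.prems t tS fl by (simp add: divide_simps flip: ennreal_mult)
  qed
qed

text \<open>The clause for rate 0 later guarantees that no point is thrown into an empty
  table.\<close>

lemma poisson_prog:
  assumes "0 \<le> rvar s 0"
  shows sure_poisson_prog: "sure (exec poisson_prog s) (\<lambda>s'. same_data s s' \<and> clock s' \<le> clock s + 6 * nvar s' 6 + 9
        \<and> (rvar s 0 = 0 \<longrightarrow> nvar s' 6 = 0))"
    and expect_poisson_prog: "expect (exec poisson_prog s) (\<lambda>s'. h (nvar s' 6)) = (\<integral>\<^sup>+ k. h k \<partial>measure_pmf (pois (rvar s 0)))"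
proof -
  define s1 where "s1 = tick (set_rvar 3 1 (tick (set_rvar 2 (exp (- rvar s 0)) (tick (set_nvar 6 0 (tick (set_nvar 5 0 s)))))))"
  have e: "exec poisson_prog s = exec poisson_loop s1"
    by (simp add: poisson_prog_def s1_def)
  \<comment> \<open>At the value 0 the tail is 1, so the conditional masses are the Poisson masses
    themselves. The 4 pays for the initial assignments.\<close>
  have *: "ennreal (pmf (pois (rvar s 0)) k) \<le> expect (exec poisson_prog s)
      (\<lambda>s'. of_bool (nvar s' 6 = k \<and> same_data s s' \<and> clock s' \<le> clock s + 6 * nvar s' 6 + 9))" for k
    using poisson_loop_lower_bound[of s s1 0 "clock s + 4" k] assms
    by (simp add: e s1_def pmf_pois pois_tail_def same_data_def add_ac)
  show "sure (exec poisson_prog s) (\<lambda>s'. same_data s s' \<and> clock s' \<le> clock s + 6 * nvar s' 6 + 9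
        \<and> (rvar s 0 = 0 \<longrightarrow> nvar s' 6 = 0))"
    by (rule sure_mono[OF sure_from_lower_bound[OF *]]) (auto simp: pois_def)
  show "expect (exec poisson_prog s) (\<lambda>s'. h (nvar s' 6)) = (\<integral>\<^sup>+ k. h k \<partial>measure_pmf (pois (rvar s 0)))"
    using * by (rule expect_from_lower_bound)
qed

section \<open>Preprocessing\<close>

text \<open>
  Items of probability above \<open>1/2\<close> are listed in the arrays 1. With \<open>u\<close> the mean probability, every
  other item is cut into pieces of Poisson rate at most \<open>u\<close> and total rate \<open>- ln (1 - w i)\<close>; each
  piece is an entry of the arrays 2, whose real part is the rate of the piece divided by \<open>u\<close>.
\<close>

definition sum_loop :: com where
  "sum_loop = While (NLess (NVar 4) (NVar 0))
    (Seq (RAssign 1 (RAdd (RVar 1) (RArr 0 (NVar 4)))) (NAssign 4 (NAdd (NVar 4) (NConst 1))))"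

definition cut_body :: com where
  "cut_body = Seq (NStore 2 (NVar 2) (NArr 0 (NVar 4)))
    (Seq (If (RLess (RVar 2) (RVar 1))
        (RStore 2 (NVar 2) (RDiv (RVar 2) (RVar 1)))
        (RStore 2 (NVar 2) (RNat (NConst 1))))
      (Seq (NAssign 2 (NAdd (NVar 2) (NConst 1))) (RAssign 2 (RSub (RVar 2) (RVar 1)))))"

definition cut_loop :: com where
  "cut_loop = While (RLess (RNat (NConst 0)) (RVar 2)) cut_body"

definition table_body :: com where
  "table_body = Seq (If (RLess (RDiv (RNat (NConst 1)) (RNat (NConst 2))) (RArr 0 (NVar 4)))
      (Seq (NStore 1 (NVar 1) (NArr 0 (NVar 4)))
        (Seq (RStore 1 (NVar 1) (RArr 0 (NVar 4))) (NAssign 1 (NAdd (NVar 1) (NConst 1)))))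
      (Seq (RAssign 2 (RSub (RNat (NConst 0)) (RLn (RSub (RNat (NConst 1)) (RArr 0 (NVar 4))))))
        cut_loop))
    (NAssign 4 (NAdd (NVar 4) (NConst 1)))"

definition table_loop :: com where
  "table_loop = While (NLess (NVar 4) (NVar 0)) table_body"

text \<open>A PE without items divides 0 by 0, which is 0; its tables and its Poisson rate are then
  empty and 0.\<close>

definition prep_prog :: com where
  "prep_prog = Seq sum_loop (Seq (RAssign 1 (RDiv (RVar 1) (RNat (NVar 0))))
    (Seq (NAssign 4 (NConst 0)) (Seq table_loop (RAssign 0 (RMul (RNat (NVar 2)) (RVar 1))))))"

section \<open>Rates and the invariants of the tables\<close>

definition rate :: "real \<Rightarrow> real" where
  "rate x = - ln (1 - x)"

text \<open>From \<open>- ln (1 - x) \<le> x + 2 * x\<^sup>2\<close>, where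
  \<open>2 * x\<^sup>2 \<le> x\<close> exactly up to 1/2. The factor 2 lets the weight of an item
  pay for its Poisson rate.\<close>

lemma rate_bounds: "0 \<le> x \<Longrightarrow> x \<le> 1/2 \<Longrightarrow> 0 \<le> rate x \<and> rate x \<le> 2 * x"
proof -
  assume x: "0 \<le> x" "x \<le> 1/2"
  have "- x - 2 * x\<^sup>2 \<le> ln (1 - x)" using x by (intro ln_one_minus_pos_lower_bound)
  moreover have "2 * x\<^sup>2 \<le> x" using x mult_left_mono[of x "1/2" x] by (simp add: power2_eq_square)
  ultimately show ?thesis using x by (simp add: rate_def)
qed

text \<open>Divided by \<open>n\<close>, this is the probability that a uniform cell followed by its
  coin yields an item outside \<open>A\<close>.\<close>

definition accept_outside :: "nat \<Rightarrow> (nat \<Rightarrow> nat) \<Rightarrow> (nat \<Rightarrow> real) \<Rightarrow> nat set \<Rightarrow> real" where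
  "accept_outside n f g A = (\<Sum>j<n. if f j \<in> A then 0 else g j)"

lemma accept_outside_Suc [simp]:
  "accept_outside (Suc n) (f(n := x)) (g(n := a)) A = accept_outside n f g A + (if x \<in> A then 0 else a)"
proof -
  have "accept_outside n (f(n := x)) (g(n := a)) A = accept_outside n f g A"
    unfolding accept_outside_def by (rule sum.cong) auto
  then show ?thesis by (simp add: accept_outside_def)
qed

lemma accept_outside_0 [simp]: "accept_outside 0 f g A = 0"
  by (simp add: accept_outside_def)

definition small_rate :: "(nat \<Rightarrow> real) \<Rightarrow> nat list \<Rightarrow> nat set \<Rightarrow> real" where
  "small_rate w ys A = (\<Sum>i\<leftarrow>ys. if w i \<le> 1/2 \<and> i \<notin> A then rate (w i) else 0)"

text \<open>The clause for all \<open>A\<close> fixes the total rate of each item in the very form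
  in which the downset probabilities use it, however the item was cut.\<close>

definition tables :: "(nat \<Rightarrow> real) \<Rightarrow> nat list \<Rightarrow> state \<Rightarrow> bool" where
  "tables w ys s \<longleftrightarrow>
    map (narr s 1) [0..<nvar s 1] = filter (\<lambda>i. 1/2 < w i) ys
    \<and> (\<forall>j<nvar s 1. rarr s 1 j = w (narr s 1 j))
    \<and> (\<forall>j<nvar s 2. narr s 2 j \<in> set ys \<and> w (narr s 2 j) \<le> 1/2 \<and> 0 \<le> rarr s 2 j \<and> rarr s 2 j \<le> 1)
    \<and> (\<forall>A. rvar s 1 * accept_outside (nvar s 2) (narr s 2) (rarr s 2) A = small_rate w ys A)
    \<and> (nvar s 2 = 0 \<or> 0 < rvar s 1)"

text \<open>The invariant that every call finds and restores. As no stamp exceeds the counter,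
  increasing the counter makes all stamps stale in one step.\<close>

definition ready :: "(nat \<Rightarrow> real) \<Rightarrow> nat list \<Rightarrow> state \<Rightarrow> bool" where
  "ready w xs s \<longleftrightarrow> tables w xs s \<and> rvar s 0 = real (nvar s 2) * rvar s 1 \<and> 0 \<le> rvar s 0
    \<and> rvar s 0 \<le> 3 * (\<Sum>i\<leftarrow>xs. w i) \<and> (\<forall>i. narr s 3 i \<le> nvar s 3)"

definition input :: "(nat \<Rightarrow> real) \<Rightarrow> nat list \<Rightarrow> state \<Rightarrow> bool" where
  "input w xs s \<longleftrightarrow> nvar s 0 = length xs \<and> (\<forall>j<length xs. narr s 0 j = xs ! j \<and> rarr s 0 j = w (xs ! j))
    \<and> nvar s 3 = 0 \<and> narr s 3 = (\<lambda>_. 0)"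

text \<open>The last subtraction may push scalar 2 below 0, by at most \<open>u\<close>; hence
  \<open>max\<close>. The overshoot is charged to the summand \<open>u\<close> of the item, and 6 is
  the cost of one cell.\<close>

definition cut_inv :: "(nat \<Rightarrow> real) \<Rightarrow> nat list \<Rightarrow> nat list \<Rightarrow> nat \<Rightarrow> nat \<Rightarrow> real \<Rightarrow> nat \<Rightarrow> state \<Rightarrow> bool" where
  "cut_inv w xs ys x i u c s \<longleftrightarrow> input w xs s \<and> nvar s 4 = i \<and> rvar s 1 = u
    \<and> map (narr s 1) [0..<nvar s 1] = filter (\<lambda>i. 1/2 < w i) ys
    \<and> (\<forall>j<nvar s 1. rarr s 1 j = w (narr s 1 j))
    \<and> (\<forall>j<nvar s 2. narr s 2 j \<in> insert x (set ys) \<and> w (narr s 2 j) \<le> 1/2 \<and> 0 \<le> rarr s 2 j \<and> rarr s 2 j \<le> 1)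
    \<and> (\<forall>A. u * accept_outside (nvar s 2) (narr s 2) (rarr s 2) A
          = small_rate w ys A + (if x \<in> A then 0 else rate (w x) - max (rvar s 2) 0))
    \<and> (nvar s 2 = 0 \<or> 0 < u) \<and> (0 < rvar s 2 \<longrightarrow> 0 < u) \<and> - u \<le> rvar s 2
    \<and> real (nvar s 2) * u \<le> (\<Sum>i\<leftarrow>ys. 2 * w i + u) + rate (w x) - rvar s 2
    \<and> clock s \<le> c + 6 * nvar s 2"

lemma sure_cut_loop:
  assumes "cut_inv w xs ys x i u c s" "i < length xs" "xs ! i = x" "w x \<le> 1/2"
  shows "sure (exec cut_loop s) (\<lambda>s'. cut_inv w xs ys x i u (Suc c) s' \<and> rvar s' 2 \<le> 0)"
  unfolding cut_loop_def
proof (rule sure_While[where I = "cut_inv w xs ys x i u c" and m = "\<lambda>s. nat \<lceil>rvar s 2 / u\<rceil>"])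
  fix s assume I: "cut_inv w xs ys x i u c s"
    and "bval (RLess (RNat (NConst 0)) (RVar 2)) s"
  then have pos: "0 < rvar s 2" "0 < u" by (simp_all add: cut_inv_def)
  define M where "M = nvar s 2"
  define a where "a = (if rvar s 2 < u then rvar s 2 / u else 1)"
  define s' where "s' = tick (set_rvar 2 (rvar s 2 - u) (tick (set_nvar 2 (Suc M)
    (tick (set_rarr 2 M a (tick (tick (set_narr 2 M x (tick s)))))))))"
  \<comment> \<open>One identity for full pieces and the shortened last one: the rate of the new
    cell is exactly what is taken from the remaining rate.\<close>
  have a: "0 \<le> a" "a \<le> 1" "u * a = max (rvar s 2) 0 - max (rvar s 2 - u) 0"
    using pos by (auto simp: a_def)
  have "clock s' \<le> c + 6 * nvar s' 2" using I by (simp add: s'_def cut_inv_def M_def)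
  moreover have "real (nvar s' 2) * u \<le> (\<Sum>i\<leftarrow>ys. 2 * w i + u) + rate (w x) - rvar s' 2"
    using I by (simp add: s'_def cut_inv_def M_def algebra_simps)
  moreover have "u * accept_outside (nvar s' 2) (narr s' 2) (rarr s' 2) A
          = small_rate w ys A + (if x \<in> A then 0 else rate (w x) - max (rvar s' 2) 0)" for A
    using I a(3) by (simp add: s'_def cut_inv_def M_def distrib_left)
  ultimately have I': "cut_inv w xs ys x i u c s'"
    using I a(1,2) pos assms by (auto simp: s'_def cut_inv_def M_def input_def less_Suc_eq)
  have "nat \<lceil>(rvar s 2 - u) / u\<rceil> < nat \<lceil>rvar s 2 / u\<rceil>"
  proof -
    have "(rvar s 2 - u) / u = rvar s 2 / u - of_int 1" using pos by (simp add: field_simps)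
    moreover have "0 < \<lceil>rvar s 2 / u\<rceil>" using pos by simp
    ultimately show ?thesis by (simp only: ceiling_diff_of_int)
  qed
  moreover have "exec cut_body (tick s)
    = return_spmf s'"
    using I assms by (simp add: cut_body_def s'_def a_def M_def cut_inv_def input_def)
  ultimately show "sure (exec cut_body (tick s))
    (\<lambda>s'. cut_inv w xs ys x i u c s' \<and> nat \<lceil>rvar s' 2 / u\<rceil> < nat \<lceil>rvar s 2 / u\<rceil>)"
    using I' by (simp add: s'_def)
next
  fix s assume "cut_inv w xs ys x i u c s" "\<not> bval (RLess (RNat (NConst 0)) (RVar 2)) s"
  then show "cut_inv w xs ys x i u (Suc c) (tick s) \<and> rvar (tick s) 2 \<le> 0"
    by (auto simp: cut_inv_def input_def)
qed (rule assms(1))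

text \<open>An item pays \<open>2 * w i\<close> for its rate and \<open>u\<close> for its last
  piece. Over all items this sums to \<open>3 * W\<close>, hence at most \<open>3 * m\<close>
  cells.\<close>

definition table_inv :: "(nat \<Rightarrow> real) \<Rightarrow> nat list \<Rightarrow> real \<Rightarrow> nat \<Rightarrow> state \<Rightarrow> bool" where
  "table_inv w xs u c s \<longleftrightarrow> input w xs s \<and> nvar s 4 \<le> length xs \<and> rvar s 1 = u
    \<and> tables w (take (nvar s 4) xs) s
    \<and> real (nvar s 2) * u \<le> (\<Sum>i\<leftarrow>take (nvar s 4) xs. 2 * w i + u)
    \<and> clock s \<le> c + 6 * (nvar s 2 + nvar s 4)"

lemma sure_table_body:
  assumes I: "table_inv w xs u c s" and w: "\<And>i. i \<in> set xs \<Longrightarrow> 0 \<le> w i"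
    and u: "0 \<le> u" "\<And>i. i \<in> set xs \<Longrightarrow> 0 < w i \<Longrightarrow> 0 < u" and i: "nvar s 4 < length xs"
  shows "sure (exec table_body (tick s))
    (\<lambda>s'. table_inv w xs u c s' \<and> length xs - nvar s' 4 < length xs - nvar s 4)"
proof -
  define i where "i = nvar s 4"
  define x where "x = xs ! i"
  define ys where "ys = take i xs"
  have wx: "0 \<le> w x" using w i by (simp add: x_def i_def)
  have tk: "take (Suc i) xs = ys @ [x]" using i by (simp add: take_Suc_conv_app_nth x_def ys_def i_def)
  have r0: "rarr s 0 i = w x" "narr s 0 i = x" "i < length xs" "nvar s 4 = i"
    using I i by (auto simp: table_inv_def input_def x_def i_def)
  show ?thesis
  proof (cases "1/2 < w x")
    case True
    then show ?thesis
      using I r0(3,4) u wx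
      by (auto simp: table_body_def r0(1,2) tk ys_def[symmetric] table_inv_def tables_def small_rate_def input_def less_Suc_eq)
  next
    case False
    then have rb: "0 \<le> rate (w x)" "rate (w x) \<le> 2 * w x" using rate_bounds wx by simp_all
    define s1 where "s1 = tick (set_rvar 2 (rate (w x)) (tick (tick s)))"
    have "cut_inv w xs ys x i u (c + 6 * i + 3) s1"
    proof -
      \<comment> \<open>Only items of positive rate enter \<open>cut_loop\<close>, and these make
        the mean positive; so \<open>u = 0\<close> cannot trap the loop.\<close>
      have "u > 0" if "0 < rate (w x)"
        using that rb r0(3) by (intro u(2)[of x]) (auto simp: x_def)
      then show ?thesis
        using I r0(3,4) rb u(1) wx False
        by (auto simp: s1_def table_inv_def cut_inv_def tables_def input_def ys_def)
    qed
    from sure_cut_loop[OF this] r0(3) False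
    have "sure (exec cut_loop s1) (\<lambda>s'. cut_inv w xs ys x i u (c + 6 * i + 4) s' \<and> rvar s' 2 \<le> 0)"
      by (simp add: x_def eval_nat_numeral)
    then have "sure (exec cut_loop s1) (\<lambda>s'. table_inv w xs u c (tick (set_nvar 4 (Suc (nvar s' 4)) s'))
        \<and> length xs - Suc (nvar s' 4) < length xs - i)"
    proof (rule sure_mono)
      fix s' assume s': "cut_inv w xs ys x i u (c + 6 * i + 4) s' \<and> rvar s' 2 \<le> 0"
      then show "table_inv w xs u c (tick (set_nvar 4 (Suc (nvar s' 4)) s'))
        \<and> length xs - Suc (nvar s' 4) < length xs - i"
        using r0(3) False rb
        by (auto simp: table_inv_def cut_inv_def tables_def input_def small_rate_def tk)
    qed
    then show ?thesis using False r0 by (simp add: table_body_def s1_def rate_def)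
  qed
qed

text \<open>For \<open>m\<close> items: \<open>3 * m + 1\<close> for the sum,
  \<open>24 * m + 1\<close> for the tables, as 6 units go to each of at most \<open>3 * m\<close>
  cells and to each item, and 3 single assignments.\<close>

lemma sure_prep_prog:
  assumes w: "\<And>i. i \<in> set xs \<Longrightarrow> 0 \<le> w i"
  shows "sure (exec prep_prog (initial_state w xs)) (\<lambda>s. ready w xs s \<and> clock s \<le> 27 * length xs + 5)"
proof -
  define s0 where "s0 = initial_state w xs"
  define W where "W = (\<Sum>i\<leftarrow>xs. w i)"
  define u where "u = W / real (length xs)"
  have W0: "0 \<le> W" using w by (auto simp: W_def intro!: sum_list_nonneg)
  have u: "0 \<le> u" "\<And>i. i \<in> set xs \<Longrightarrow> 0 < w i \<Longrightarrow> 0 < u"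
  proof -
    show "0 \<le> u" using W0 by (simp add: u_def)
    fix i assume i: "i \<in> set xs" "0 < w i"
    have "w i \<le> W" unfolding W_def using i w by (intro member_le_sum_list) auto
    then show "0 < u" using i by (auto simp: u_def intro!: divide_pos_pos)
  qed
  define J where "J = (\<lambda>s. input w xs s \<and> nvar s 4 \<le> length xs \<and> nvar s 1 = 0 \<and> nvar s 2 = 0
    \<and> rvar s 1 = (\<Sum>i\<leftarrow>take (nvar s 4) xs. w i) \<and> clock s \<le> 3 * nvar s 4)"
  have A: "sure (exec sum_loop s0) (\<lambda>s. input w xs s \<and> nvar s 1 = 0 \<and> nvar s 2 = 0 \<and> rvar s 1 = W
      \<and> clock s \<le> 3 * length xs + 1)"
    unfolding sum_loop_def
    by (rule sure_While[where I = J and m = "\<lambda>s. length xs - nvar s 4"])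
      (auto simp: J_def s0_def initial_state_def input_def take_Suc_conv_app_nth W_def)
  have B: "sure (exec table_loop s) (\<lambda>s. table_inv w xs u (3 * length xs + 4) s \<and> nvar s 4 = length xs)"
    if "table_inv w xs u (3 * length xs + 3) s" for s
    unfolding table_loop_def
    by (rule sure_While[where I = "table_inv w xs u (3 * length xs + 3)" and m = "\<lambda>s. length xs - nvar s 4"],
      rule that, rule sure_table_body)
      (use w u in \<open>auto simp: table_inv_def input_def tables_def\<close>)
  have C: "ready w xs s' \<and> clock s' \<le> 27 * length xs + 5"
    if s: "table_inv w xs u (3 * length xs + 4) s" "nvar s 4 = length xs"
      and s': "s' = tick (set_rvar 0 (real (nvar s 2) * u) s)" for s s'
  proof -
    have "(\<Sum>i\<leftarrow>xs. 2 * w i + u) = 2 * W + real (length xs) * u"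
      by (simp add: W_def sum_list_addf sum_list_const_mult sum_list_triv)
    also have "\<dots> = 3 * W" by (cases "xs = []") (simp_all add: u_def W_def)
    finally have M: "real (nvar s 2) * u \<le> 3 * W" using s by (simp add: table_inv_def)
    have "nvar s 2 \<le> 3 * length xs"
    proof (cases "nvar s 2 = 0")
      case False
      then have "0 < u" using s by (auto simp: table_inv_def tables_def)
      then have "real (nvar s 2) * u \<le> real (3 * length xs) * u"
        using M by (auto simp: u_def)
      then show ?thesis using \<open>0 < u\<close> by simp
    qed simp
    then show ?thesis
      using s M u by (auto simp: s' ready_def table_inv_def tables_def input_def W_def)
  qed
  have "sure (exec sum_loop s0) (\<lambda>s. sure (exec table_loop
      (tick (set_nvar 4 0 (tick (set_rvar 1 (rvar s 1 / real (nvar s 0)) s)))))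
      (\<lambda>s. ready w xs (tick (set_rvar 0 (real (nvar s 2) * rvar s 1) s))
        \<and> clock (tick (set_rvar 0 (real (nvar s 2) * rvar s 1) s)) \<le> 27 * length xs + 5))"
  proof (rule sure_mono[OF A])
    fix s assume s: "input w xs s \<and> nvar s 1 = 0 \<and> nvar s 2 = 0 \<and> rvar s 1 = W
      \<and> clock s \<le> 3 * length xs + 1"
    let ?s = "tick (set_nvar 4 0 (tick (set_rvar 1 (rvar s 1 / real (nvar s 0)) s)))"
    have "table_inv w xs u (3 * length xs + 3) ?s"
      using s by (auto simp: table_inv_def tables_def small_rate_def input_def u_def)
    from B[OF this] show "sure (exec table_loop ?s)
      (\<lambda>s. ready w xs (tick (set_rvar 0 (real (nvar s 2) * rvar s 1) s))
        \<and> clock (tick (set_rvar 0 (real (nvar s 2) * rvar s 1) s)) \<le> 27 * length xs + 5)"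
    proof (rule sure_mono)
      fix s' assume s': "table_inv w xs u (3 * length xs + 4) s' \<and> nvar s' 4 = length xs"
      then have "rvar s' 1 = u" by (simp add: table_inv_def)
      with s' show "ready w xs (tick (set_rvar 0 (real (nvar s' 2) * rvar s' 1) s'))
        \<and> clock (tick (set_rvar 0 (real (nvar s' 2) * rvar s' 1) s')) \<le> 27 * length xs + 5"
        using C[of s' "tick (set_rvar 0 (real (nvar s' 2) * u) s')"] by simp
    qed
  qed
  then show ?thesis by (simp add: prep_prog_def s0_def)
qed

section \<open>Sampling\<close>

definition large_body :: com where
  "large_body = Seq (Flip 5 (RArr 1 (NVar 4)))
      (Seq (If (NLess (NConst 0) (NVar 5)) (Emit (NArr 1 (NVar 4))) Skip)
        (NAssign 4 (NAdd (NVar 4) (NConst 1))))"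

definition large_loop :: com where
  "large_loop = While (NLess (NVar 4) (NVar 1)) large_body"

text \<open>Array 3 holds the number of the last call in which an item was reported through the table.\<close>

definition throw_body :: com where
  "throw_body = Seq (Flip 5 (RArr 2 (NVar 7)))
    (Seq (If (NLess (NConst 0) (NVar 5))
        (If (NLess (NArr 3 (NArr 2 (NVar 7))) (NVar 3))
          (Seq (NStore 3 (NArr 2 (NVar 7)) (NVar 3)) (Emit (NArr 2 (NVar 7))))
          Skip)
        Skip)
      (NAssign 4 (NAdd (NVar 4) (NConst 1))))"

definition ball_body :: com where
  "ball_body = Seq (Uniform 7 (NVar 2)) throw_body"

definition ball_loop :: com where
  "ball_loop = While (NLess (NVar 4) (NVar 6)) ball_body"

definition samp_prog :: com where
  "samp_prog = Seq (NAssign 3 (NAdd (NVar 3) (NConst 1))) (Seq (NAssign 4 (NConst 0))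
    (Seq large_loop (Seq poisson_prog (Seq (NAssign 4 (NConst 0)) ball_loop))))"

section \<open>Items of probability at most 1/2: the thrown points\<close>

definition emits_in :: "nat set \<Rightarrow> state \<Rightarrow> ennreal" where
  "emits_in A s = of_bool (set (emitted s) \<subseteq> A)"

text \<open>The factor of item \<open>i\<close> in the probability that the sample lies in
  \<open>A\<close>.\<close>

definition avoid :: "(nat \<Rightarrow> real) \<Rightarrow> nat set \<Rightarrow> nat \<Rightarrow> real" where
  "avoid w A i = (if i \<in> A then 1 else 1 - w i)"

text \<open>The stamp clause speaks of table items only, since items reported by single coins are
  never stamped. A point costs at most 8 units.\<close>

definition ball_inv :: "(nat \<Rightarrow> real) \<Rightarrow> nat list \<Rightarrow> real \<Rightarrow> nat \<Rightarrow> nat \<Rightarrow> state \<Rightarrow> bool" where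
  "ball_inv w xs \<mu> n c s \<longleftrightarrow> ready w xs s \<and> rvar s 0 = \<mu> \<and> nvar s 6 = n \<and> (n = 0 \<or> 0 < \<mu>) \<and> nvar s 4 \<le> n
    \<and> distinct (emitted s) \<and> set (emitted s) \<subseteq> set xs
    \<and> (\<forall>j<nvar s 2. narr s 3 (narr s 2 j) < nvar s 3 \<longleftrightarrow> narr s 2 j \<notin> set (emitted s))
    \<and> clock s \<le> c + 8 * nvar s 4"

lemma sure_ball_body:
  assumes "ball_inv w xs \<mu> n c s" "nvar s 4 < n"
  shows "sure (exec ball_body (tick s))
    (\<lambda>s'. ball_inv w xs \<mu> n c s' \<and> n - nvar s' 4 < n - nvar s 4)"
proof -
  have M: "0 < nvar s 2" using assms by (cases "nvar s 2") (auto simp: ball_inv_def ready_def)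
  show ?thesis
    apply (simp only: ball_body_def throw_body_def exec.simps(9) sure_bind)
    apply (subst sure_exec_Uniform)
     apply (simp add: M)
    apply (intro allI impI)
    apply (rule sure_exec_Flip)
    using assms
     apply (auto simp: ball_inv_def ready_def tables_def)
    done
qed

lemma accept_outside_bounds:
  assumes "\<And>j. j < n \<Longrightarrow> 0 \<le> g j \<and> g j \<le> 1"
  shows "0 \<le> accept_outside n f g A" "accept_outside n f g A \<le> n"
proof -
  show "0 \<le> accept_outside n f g A" unfolding accept_outside_def using assms by (intro sum_nonneg) auto
  have "accept_outside n f g A \<le> (\<Sum>j<n. 1)" unfolding accept_outside_def using assms by (intro sum_mono) auto
  then show "accept_outside n f g A \<le> n" by simp
qed

text \<open>\<open>z\<close> is the probability that one point does not yield an item outside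
  \<open>A\<close>. The cell rate cancels: \<open>accept_outside\<close> over the number of cells
  equals \<open>small_rate\<close> over \<open>\<mu>\<close>.\<close>

lemma expect_ball_body:
  fixes A :: "nat set"
  assumes I: "ball_inv w xs \<mu> n c s" "nvar s 4 < n"
  defines "z \<equiv> 1 - small_rate w xs A / \<mu>"
  shows "0 \<le> z" "expect (exec ball_body (tick s))
    (\<lambda>s'. emits_in A s' * ennreal (z ^ (n - nvar s' 4))) = emits_in A s * ennreal (z ^ (n - nvar s 4))"
proof -
  define M where "M = nvar s 2"
  define q where "q j = (if narr s 2 j \<in> A then 0 else rarr s 2 j)" for j
  have a: "0 \<le> rarr s 2 j \<and> rarr s 2 j \<le> 1" if "j < M" for j
    using that I by (auto simp: ball_inv_def ready_def tables_def M_def)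
  have M: "0 < M" using I by (cases "nvar s 2") (auto simp: ball_inv_def ready_def M_def)
  then have "0 < rvar s 1"
    using I by (auto simp: ball_inv_def ready_def tables_def M_def)
  moreover have "small_rate w xs A = rvar s 1 * sum q {..<M}" "\<mu> = real M * rvar s 1"
    using I by (simp_all add: q_def accept_outside_def ball_inv_def ready_def tables_def M_def)
  ultimately have zq: "z = (real M - sum q {..<M}) / real M"
    using M by (simp add: z_def field_simps)
  have mb: "sum q {..<M} \<le> M"
    using accept_outside_bounds(2)[of M "rarr s 2" "narr s 2" A] a by (simp add: q_def accept_outside_def)
  then show "0 \<le> z" using M by (simp add: zq)
  define \<zeta> where "\<zeta> = ennreal (z ^ (n - Suc (nvar s 4)))"
  \<comment> \<open>Suppressing repetitions is harmless: an accepted item outside \<open>A\<close>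
    that is already stamped has been emitted before, so \<open>emits_in A s\<close> is 0 and both
    sides vanish.\<close>
  have 1: "expect (exec throw_body (tick (set_nvar 7 j (tick s))))
      (\<lambda>s'. emits_in A s' * ennreal (z ^ (n - nvar s' 4)))
    = emits_in A s * \<zeta> * ennreal (1 - q j)" if j: "j < M" for j
  proof -
    have st: "narr s 3 (narr s 2 j) < nvar s 3 \<longleftrightarrow> narr s 2 j \<notin> set (emitted s)"
      using j I by (simp add: ball_inv_def M_def)
    have e: "ennreal (rarr s 2 j) + ennreal (1 - rarr s 2 j) = 1"
      using a[OF j] by (simp flip: ennreal_plus)
    show ?thesis
      apply (simp only: throw_body_def exec.simps(9) expect_bind)
      apply (subst expect_exec_Flip)
      using a[OF j] apply (simp, simp)
      using e st
      apply (auto simp: emits_in_def \<zeta>_def[symmetric] q_def simp flip: distrib_left)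
      done
  qed
  have "expect (exec ball_body (tick s))
    (\<lambda>s'. emits_in A s' * ennreal (z ^ (n - nvar s' 4)))
    = (\<Sum>j<M. emits_in A s * \<zeta> * ennreal (1 - q j)) / of_nat M"
    apply (simp only: ball_body_def exec.simps(9) expect_bind)
    apply (subst expect_exec_Uniform)
    using M apply (simp add: M_def)
    using 1 apply (simp add: M_def)
    done
  also have "\<dots> = emits_in A s * \<zeta> * ((\<Sum>j<M. ennreal (1 - q j)) / of_nat M)"
    by (simp add: sum_distrib_left[symmetric] ennreal_times_divide)
  also have "(\<Sum>j<M. ennreal (1 - q j)) = ennreal (\<Sum>j<M. 1 - q j)"
    using a by (intro sum_ennreal) (auto simp: q_def)
  also have "(\<Sum>j<M. 1 - q j) = real M - sum q {..<M}" by (simp add: sum_subtractf)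
  also have "ennreal (real M - sum q {..<M}) / of_nat M = ennreal z"
    using M mb by (simp add: zq divide_ennreal ennreal_of_nat_eq_real_of_nat)
  also have "emits_in A s * \<zeta> * ennreal z = emits_in A s * ennreal (z ^ (n - nvar s 4))"
  proof -
    have "n - nvar s 4 = Suc (n - Suc (nvar s 4))" using I by simp
    then show ?thesis using \<open>0 \<le> z\<close> by (simp add: \<zeta>_def ennreal_mult mult_ac)
  qed
  finally show "expect (exec ball_body (tick s))
    (\<lambda>s'. emits_in A s' * ennreal (z ^ (n - nvar s' 4))) = emits_in A s * ennreal (z ^ (n - nvar s 4))" .
qed

lemma sure_ball_loop:
  assumes "ball_inv w xs \<mu> n c s"
  shows "sure (exec ball_loop s) (\<lambda>s'. ready w xs s' \<and> distinct (emitted s') \<and> set (emitted s') \<subseteq> set xs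
    \<and> clock s' \<le> c + 8 * n + 1)"
  unfolding ball_loop_def
proof (rule sure_While[where I = "ball_inv w xs \<mu> n c" and m = "\<lambda>s. n - nvar s 4"])
  fix s assume "ball_inv w xs \<mu> n c s" "bval (NLess (NVar 4) (NVar 6)) s"
  then show "sure (exec ball_body (tick s)) (\<lambda>s'. ball_inv w xs \<mu> n c s' \<and> n - nvar s' 4 < n - nvar s 4)"
    by (intro sure_ball_body) (auto simp: ball_inv_def)
qed (use assms in \<open>auto simp: ball_inv_def ready_def tables_def\<close>)

lemma expect_ball_loop:
  assumes I: "ball_inv w xs \<mu> n c s" and "nvar s 4 = 0"
  shows "expect (exec ball_loop s) (emits_in A) = emits_in A s * ennreal ((1 - small_rate w xs A / \<mu>) ^ n)"
proof -
  let ?z = "1 - small_rate w xs A / \<mu>"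
  have "expect (exec ball_loop s) (emits_in A) = emits_in A s * ennreal (?z ^ (n - nvar s 4))"
    unfolding ball_loop_def
  proof (rule expect_While[where I = "ball_inv w xs \<mu> n c" and m = "\<lambda>s. n - nvar s 4"])
    fix s assume I: "ball_inv w xs \<mu> n c s" and b: "bval (NLess (NVar 4) (NVar 6)) s"
    then have b': "nvar s 4 < n" by (auto simp: ball_inv_def)
    show "sure (exec ball_body (tick s)) (\<lambda>s'. ball_inv w xs \<mu> n c s' \<and> n - nvar s' 4 < n - nvar s 4)"
      by (rule sure_ball_body[OF I b'])
    show "expect (exec ball_body (tick s)) (\<lambda>s. emits_in A s * ennreal (?z ^ (n - nvar s 4)))
      = emits_in A s * ennreal (?z ^ (n - nvar s 4))"
      by (rule expect_ball_body(2)[OF I b'])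
  next
    fix s assume "ball_inv w xs \<mu> n c s" "\<not> bval (NLess (NVar 4) (NVar 6)) s"
    then have "n - nvar s 4 = 0" by (auto simp: ball_inv_def)
    then show "emits_in A (tick s) = emits_in A s * ennreal (?z ^ (n - nvar s 4))"
      by (simp add: emits_in_def)
  qed (rule I)
  then show ?thesis by (simp add: assms)
qed

definition large :: "(nat \<Rightarrow> real) \<Rightarrow> nat list \<Rightarrow> nat list" where
  "large w xs = filter (\<lambda>i. 1/2 < w i) xs"

definition half_done :: "(nat \<Rightarrow> real) \<Rightarrow> nat list \<Rightarrow> state \<Rightarrow> bool" where
  "half_done w xs s \<longleftrightarrow> ready w xs s \<and> distinct (emitted s) \<and> set (emitted s) \<subseteq> set (large w xs)
    \<and> (\<forall>i. narr s 3 i < nvar s 3)"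

text \<open>Items emitted so far have probability above 1/2 and table items at most 1/2, so no item
  can be reported by both phases.\<close>

lemma half_done_ball_inv:
  assumes "half_done w xs s" "same_data s s'" "clock s' \<le> c" "rvar s 0 = 0 \<longrightarrow> nvar s' 6 = 0"
  shows "ball_inv w xs (rvar s 0) (nvar s' 6) (Suc c) (tick (set_nvar 4 0 s'))"
proof -
  have r: "ready w xs s" and em: "distinct (emitted s)" "set (emitted s) \<subseteq> set (large w xs)"
    and st: "narr s 3 i < nvar s 3" for i
    using assms(1) by (simp_all add: half_done_def)
  have r': "ready w xs (tick (set_nvar 4 0 s'))"
    using r assms(2) by (simp add: ready_def tables_def same_data_def)
  have "narr s 2 j \<notin> set (emitted s)" if "j < nvar s 2" for j
  proof -
    have "w (narr s 2 j) \<le> 1/2" using r that by (simp add: ready_def tables_def)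
    then show ?thesis using em(2) by (auto simp: large_def)
  qed
  moreover have "0 \<le> rvar s 0" using r by (simp add: ready_def)
  then have "nvar s' 6 = 0 \<or> 0 < rvar s 0" using assms(4) by linarith
  moreover have "set (emitted s) \<subseteq> set xs" using em(2) by (auto simp: large_def)
  ultimately show ?thesis
    using r' em(1) st assms(2,3) by (simp add: ball_inv_def same_data_def)
qed

definition small_prog :: com where
  "small_prog = Seq poisson_prog (Seq (NAssign 4 (NConst 0)) ball_loop)"

text \<open>Averaging \<open>z ^ N\<close> over the Poisson number \<open>N\<close> turns the
  rejection probability into \<open>exp (- small_rate w xs A)\<close>. In the time bound, a point
  costs 6 in the search and 8 in the throw, hence \<open>exp 14\<close>; 11 is 9 for the rest of the
  search, an assignment and the loop exit.\<close>

lemma small_prog: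
  assumes s: "half_done w xs s"
  shows sure_small_prog: "sure (exec small_prog s) (\<lambda>s'. ready w xs s' \<and> distinct (emitted s') \<and> set (emitted s') \<subseteq> set xs)"
    and expect_small_prog: "expect (exec small_prog s) (emits_in A) = emits_in A s * ennreal (exp (- small_rate w xs A))"
    and time_small_prog: "expect (exec small_prog s) (\<lambda>s. ennreal (exp (real (clock s))))
      \<le> ennreal (exp (real (clock s) + 11 + (exp 14 - 1) * rvar s 0))"
proof -
  have \<mu>: "0 \<le> rvar s 0" using s by (simp add: half_done_def ready_def)
  note sp = sure_poisson_prog[OF \<mu>]
  have inv: "ball_inv w xs (rvar s 0) (nvar s' 6) (clock s + 6 * nvar s' 6 + 10) (tick (set_nvar 4 0 s'))"
    if "same_data s s' \<and> clock s' \<le> clock s + 6 * nvar s' 6 + 9 \<and> (rvar s 0 = 0 \<longrightarrow> nvar s' 6 = 0)" for s'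
    using half_done_ball_inv[OF s, of s' "clock s + 6 * nvar s' 6 + 9"] that by (simp add: add_ac)
  show "sure (exec small_prog s) (\<lambda>s'. ready w xs s' \<and> distinct (emitted s') \<and> set (emitted s') \<subseteq> set xs)"
    unfolding small_prog_def exec.simps sure_bind sure_return nval.simps
    by (rule sure_mono[OF sp], rule sure_mono[OF sure_ball_loop[OF inv]]) auto
  let ?z = "1 - small_rate w xs A / rvar s 0"
  have "accept_outside (nvar s 2) (narr s 2) (rarr s 2) A \<le> nvar s 2" "0 \<le> rvar s 1 \<or> nvar s 2 = 0"
    using s by (auto simp: half_done_def ready_def tables_def intro!: accept_outside_bounds)
  then have "rvar s 1 * accept_outside (nvar s 2) (narr s 2) (rarr s 2) A \<le> rvar s 1 * nvar s 2"
    by (cases "nvar s 2 = 0") (auto intro!: mult_left_mono)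
  moreover have sr: "small_rate w xs A = rvar s 1 * accept_outside (nvar s 2) (narr s 2) (rarr s 2) A"
    "rvar s 0 = nvar s 2 * rvar s 1" "nvar s 2 = 0 \<or> 0 < rvar s 1"
    using s by (auto simp: half_done_def ready_def tables_def)
  ultimately have "small_rate w xs A \<le> rvar s 0" by (simp add: mult.commute)
  then have z: "0 \<le> ?z" using \<mu> by (cases "rvar s 0 = 0") auto
  \<comment> \<open>If \<open>rvar s 0 = 0\<close>, the table is empty, so \<open>small_rate\<close>
    is 0, and division by 0 makes \<open>?z\<close> equal to 1: both sides vanish.\<close>
  have \<mu>z: "rvar s 0 * (?z - 1) = - small_rate w xs A"
    using sr by (cases "rvar s 0 = 0") (auto simp: accept_outside_def)
  have "expect (exec small_prog s) (emits_in A)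
      = expect (exec poisson_prog s) (\<lambda>s'. emits_in A s * ennreal (?z ^ nvar s' 6))"
    unfolding small_prog_def exec.simps expect_bind expect_return nval.simps
    by (rule expect_cong[OF sp], subst expect_ball_loop[OF inv]) (auto simp: emits_in_def same_data_def)
  also have "\<dots> = emits_in A s * ennreal (exp (- small_rate w xs A))"
    by (subst expect_cmult, subst expect_poisson_prog[OF \<mu>]) (simp only: nn_integral_pois_power[OF \<mu> z] \<mu>z)
  finally show "expect (exec small_prog s) (emits_in A) = emits_in A s * ennreal (exp (- small_rate w xs A))" .
  have "expect (exec small_prog s) (\<lambda>s. ennreal (exp (real (clock s))))
      \<le> expect (exec poisson_prog s) (\<lambda>s'. ennreal (exp (real (clock s) + 11)) * ennreal (exp 14 ^ nvar s' 6))"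
    unfolding small_prog_def exec.simps expect_bind expect_return
  proof (rule expect_mono[OF sp])
    fix s' assume a: "same_data s s' \<and> clock s' \<le> clock s + 6 * nvar s' 6 + 9 \<and> (rvar s 0 = 0 \<longrightarrow> nvar s' 6 = 0)"
    show "expect (exec ball_loop (tick (set_nvar 4 (nval (NConst 0) s') s'))) (\<lambda>s. ennreal (exp (real (clock s))))
      \<le> ennreal (exp (real (clock s) + 11)) * ennreal (exp 14 ^ nvar s' 6)"
      unfolding nval.simps
      by (rule expect_le[OF sure_ball_loop[OF inv[OF a]]])
        (simp add: exp_of_nat_mult[symmetric] flip: ennreal_mult exp_add)
  qed
  also have "\<dots> = ennreal (exp (real (clock s) + 11)) * ennreal (exp (rvar s 0 * (exp 14 - 1)))"
    by (subst expect_cmult, subst expect_poisson_prog[OF \<mu>]) (simp add: nn_integral_pois_power[OF \<mu>])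
  also have "\<dots> = ennreal (exp (real (clock s) + 11 + (exp 14 - 1) * rvar s 0))"
    by (simp add: exp_add mult.commute flip: ennreal_mult)
  finally show "expect (exec small_prog s) (\<lambda>s. ennreal (exp (real (clock s))))
      \<le> ennreal (exp (real (clock s) + 11 + (exp 14 - 1) * rvar s 0))" .
qed

section \<open>Items of probability above 1/2: single coins\<close>

definition large_inv :: "(nat \<Rightarrow> real) \<Rightarrow> nat list \<Rightarrow> nat \<Rightarrow> state \<Rightarrow> bool" where
  "large_inv w xs c s \<longleftrightarrow> ready w xs s \<and> (\<forall>i. narr s 3 i < nvar s 3) \<and> nvar s 4 \<le> length (large w xs)
    \<and> distinct (emitted s) \<and> set (emitted s) \<subseteq> set (take (nvar s 4) (large w xs))
    \<and> clock s \<le> c + 5 * nvar s 4"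

lemma ready_large:
  assumes "ready w xs s"
  shows "nvar s 1 = length (large w xs)"
    and "i < length (large w xs) \<Longrightarrow> narr s 1 i = large w xs ! i"
    and "i < length (large w xs) \<Longrightarrow> rarr s 1 i = w (large w xs ! i)"
proof -
  have m: "map (narr s 1) [0..<nvar s 1] = large w xs"
    using assms by (simp add: ready_def tables_def large_def)
  show l: "nvar s 1 = length (large w xs)" using arg_cong[OF m, of length] by simp
  assume i: "i < length (large w xs)"
  show n: "narr s 1 i = large w xs ! i" using arg_cong[OF m, of "\<lambda>l. l ! i"] i l by simp
  show "rarr s 1 i = w (large w xs ! i)" using assms i l n by (simp add: ready_def tables_def)
qed

lemma ready_scratch [simp]:
  "ready w xs (tick s) \<longleftrightarrow> ready w xs s" "ready w xs (emit v s) \<longleftrightarrow> ready w xs s"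
  "4 \<le> x \<Longrightarrow> ready w xs (set_nvar x v s) \<longleftrightarrow> ready w xs s"
  by (auto simp: ready_def tables_def)

lemma sure_large_body:
  assumes I: "large_inv w xs c s" and d: "distinct xs" and i: "nvar s 4 < length (large w xs)"
  shows "sure (exec large_body (tick s))
    (\<lambda>s'. large_inv w xs c s' \<and> length (large w xs) - nvar s' 4 < length (large w xs) - nvar s 4)"
proof -
  have d': "distinct (take (Suc (nvar s 4)) (large w xs))" using d by (simp add: large_def)
  have "ready w xs s" using I by (simp add: large_inv_def)
  note rl = ready_large(2)[OF this i, simplified]
  have tk: "take (Suc (nvar s 4)) (large w xs) = take (nvar s 4) (large w xs) @ [large w xs ! nvar s 4]"
    using i by (simp add: take_Suc_conv_app_nth)
  have "set (emitted s) \<subseteq> set (take (nvar s 4) (large w xs))" "distinct (emitted s)"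
    using I by (auto simp: large_inv_def)
  then have new: "distinct (emitted s @ [large w xs ! nvar s 4])"
    "set (emitted s @ [large w xs ! nvar s 4]) \<subseteq> set (take (Suc (nvar s 4)) (large w xs))"
    "set (emitted s) \<subseteq> set (take (Suc (nvar s 4)) (large w xs))"
    using d' unfolding tk by auto
  show ?thesis
    unfolding large_body_def exec.simps(9) sure_bind
    by (rule sure_exec_Flip) (use I i new in \<open>simp_all add: large_inv_def rl diff_less_mono2\<close>)
qed

lemma sure_large_loop:
  assumes I: "large_inv w xs c s" and d: "distinct xs"
  shows "sure (exec large_loop s)
    (\<lambda>s'. half_done w xs s' \<and> clock s' \<le> c + 5 * length (large w xs) + 1)"
  unfolding large_loop_def
proof (rule sure_While[where I = "large_inv w xs c" and m = "\<lambda>s. length (large w xs) - nvar s 4"])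
  fix s assume I: "large_inv w xs c s" and b: "bval (NLess (NVar 4) (NVar 1)) s"
  then have "nvar s 4 < length (large w xs)" using ready_large(1)[of w xs s] by (simp add: large_inv_def)
  then show "sure (exec large_body (tick s))
    (\<lambda>s'. large_inv w xs c s' \<and> length (large w xs) - nvar s' 4 < length (large w xs) - nvar s 4)"
    by (rule sure_large_body[OF I d])
next
  fix s assume I: "large_inv w xs c s" and b: "\<not> bval (NLess (NVar 4) (NVar 1)) s"
  then show "half_done w xs (tick s) \<and> clock (tick s) \<le> c + 5 * length (large w xs) + 1"
    using ready_large(1)[of w xs s] by (auto simp: large_inv_def half_done_def ready_def tables_def)
qed (rule I)

text \<open>The martingale is the indicator of success so far times the factors \<open>avoid\<close>
  of the items not yet flipped.\<close>

lemma expect_large_loop: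
  assumes I: "large_inv w xs c s" and i0: "nvar s 4 = 0" and d: "distinct xs"
    and w: "\<And>i. i \<in> set xs \<Longrightarrow> 0 \<le> w i \<and> w i \<le> 1"
  shows "expect (exec large_loop s) (emits_in A) = emits_in A s * ennreal (prod_list (map (avoid w A) (large w xs)))"
proof -
  let ?P = "\<lambda>i. prod_list (map (avoid w A) (drop i (large w xs)))"
  have P0: "0 \<le> ?P i" for i
    using w by (intro prod_list_nonneg) (auto simp: avoid_def large_def dest!: in_set_dropD)
  have "expect (exec large_loop s) (emits_in A) = emits_in A s * ennreal (?P (nvar s 4))"
    unfolding large_loop_def
  proof (rule expect_While[where I = "large_inv w xs c" and m = "\<lambda>s. length (large w xs) - nvar s 4"])
    fix s assume I: "large_inv w xs c s" and b: "bval (NLess (NVar 4) (NVar 1)) s"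
    then have i: "nvar s 4 < length (large w xs)" using ready_large(1)[of w xs s] by (simp add: large_inv_def)
    show "sure (exec large_body (tick s))
      (\<lambda>s'. large_inv w xs c s' \<and> length (large w xs) - nvar s' 4 < length (large w xs) - nvar s 4)"
      by (rule sure_large_body[OF I d i])
    have "ready w xs s" using I by (simp add: large_inv_def)
    note rl = ready_large(2,3)[OF this i]
    define x where "x = large w xs ! nvar s 4"
    have "x \<in> set (large w xs)" unfolding x_def using i by (rule nth_mem)
    then have x: "0 \<le> w x" "w x \<le> 1" using w by (auto simp: large_def)
    have dr: "?P (nvar s 4) = avoid w A x * ?P (Suc (nvar s 4))"
      using i by (simp add: Cons_nth_drop_Suc[symmetric] x_def)
    have e: "ennreal (w x) + ennreal (1 - w x) = 1"
      using x by (simp flip: ennreal_plus)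
    have "expect (exec large_body (tick s)) (\<lambda>s. emits_in A s * ennreal (?P (nvar s 4)))
      = emits_in A s * ennreal (?P (Suc (nvar s 4))) * ennreal (avoid w A x)"
      unfolding large_body_def exec.simps(9) expect_bind
      apply (subst expect_exec_Flip)
      using x apply (simp add: rl[simplified] x_def, simp add: rl[simplified] x_def)
      using e apply (auto simp: rl[simplified] emits_in_def avoid_def x_def[symmetric] simp flip: distrib_left)
      done
    also have "\<dots> = emits_in A s * ennreal (?P (nvar s 4))"
      using P0[of "Suc (nvar s 4)"] x by (simp add: dr ennreal_mult avoid_def mult_ac)
    finally show "expect (exec large_body (tick s)) (\<lambda>s. emits_in A s * ennreal (?P (nvar s 4)))
      = emits_in A s * ennreal (?P (nvar s 4))" .
  next
    fix s assume "large_inv w xs c s" "\<not> bval (NLess (NVar 4) (NVar 1)) s"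
    then show "emits_in A (tick s) = emits_in A s * ennreal (?P (nvar s 4))"
      using ready_large(1)[of w xs s] by (simp add: emits_in_def large_inv_def)
  qed (rule I)
  then show ?thesis by (simp add: i0)
qed

section \<open>One complete call\<close>

text \<open>As \<open>exp (- rate x) = 1 - x\<close>, the exponential supplies the factors that the
  list \<open>large\<close> omits.\<close>

lemma avoid_split:
  assumes "\<And>i. i \<in> set xs \<Longrightarrow> w i \<le> 1"
  shows "prod_list (map (avoid w A) (large w xs)) * exp (- small_rate w xs A) = prod_list (map (avoid w A) xs)"
  using assms
proof (induction xs)
  case (Cons x xs)
  have IH: "prod_list (map (avoid w A) (large w xs)) * exp (- small_rate w xs A) = prod_list (map (avoid w A) xs)"
    using Cons by simp
  show ?case
  proof (cases "1/2 < w x")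
    case True
    then show ?thesis by (simp add: large_def small_rate_def IH[unfolded large_def small_rate_def, simplified] mult.assoc)
  next
    case False
    let ?r = "if x \<notin> A then rate (w x) else 0"
    have "exp (- small_rate w (x # xs) A) = exp (- ?r) * exp (- small_rate w xs A)"
      using False by (simp add: small_rate_def flip: exp_add)
    moreover have "exp (- ?r) = avoid w A x" using False by (simp add: rate_def avoid_def)
    ultimately show ?thesis
      using False by (simp add: large_def mult.left_commute IH[unfolded large_def, simplified])
  qed
qed (simp add: large_def small_rate_def)

lemma large_length:
  assumes "\<And>i. i \<in> set xs \<Longrightarrow> 0 \<le> w i"
  shows "real (length (large w xs)) \<le> 2 * (\<Sum>i\<leftarrow>xs. w i)"
  using assms by (induction xs) (fastforce simp: large_def)+

text \<open>The coins take \<open>3 + 5 * length (large w xs)\<close>, at most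
  \<open>3 + 10 * W\<close>; the points add 11 and a Poisson exponent of mean at most
  \<open>3 * W\<close>. This explains 14, 10 and 3.\<close>

lemma samp_prog:
  assumes s: "ready w xs s" and d: "distinct xs"
    and w: "\<And>i. i \<in> set xs \<Longrightarrow> 0 \<le> w i \<and> w i \<le> 1"
    and init: "emitted s = []" "clock s = 0"
  shows sure_samp_prog: "sure (exec samp_prog s) (\<lambda>s'. ready w xs s' \<and> distinct (emitted s') \<and> set (emitted s') \<subseteq> set xs)"
    and expect_samp_prog: "expect (exec samp_prog s) (emits_in A) = ennreal (prod_list (map (avoid w A) xs))"
    and time_samp_prog: "expect (exec samp_prog s) (\<lambda>s. ennreal (exp (real (clock s))))
      \<le> ennreal (exp (14 + (10 + 3 * (exp 14 - 1)) * (\<Sum>i\<leftarrow>xs. w i)))"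
proof -
  define s1 where "s1 = tick (set_nvar 4 0 (tick (set_nvar 3 (Suc (nvar s 3)) s)))"
  have e: "exec samp_prog s = bind_spmf (exec large_loop s1) (exec small_prog)"
    by (simp add: samp_prog_def small_prog_def s1_def)
  have I: "large_inv w xs 2 s1"
    using s init by (auto simp: s1_def large_inv_def ready_def tables_def le_imp_less_Suc le_SucI)
  have i0: "nvar s1 4 = 0" by (simp add: s1_def)
  note sl = sure_large_loop[OF I d]
  show "sure (exec samp_prog s) (\<lambda>s'. ready w xs s' \<and> distinct (emitted s') \<and> set (emitted s') \<subseteq> set xs)"
    unfolding e sure_bind by (rule sure_mono[OF sl]) (blast intro: sure_small_prog)
  have "expect (exec samp_prog s) (emits_in A)
      = expect (exec large_loop s1) (\<lambda>s'. emits_in A s' * ennreal (exp (- small_rate w xs A)))"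
    unfolding e expect_bind by (rule expect_cong[OF sl]) (blast intro: expect_small_prog)
  also have "\<dots> = ennreal (prod_list (map (avoid w A) (large w xs)) * exp (- small_rate w xs A))"
    by (simp only: expect_multc expect_large_loop[OF I i0 d w])
      (simp add: emits_in_def s1_def init ennreal_mult'')
  also have "\<dots> = ennreal (prod_list (map (avoid w A) xs))"
    using w by (simp add: avoid_split)
  finally show "expect (exec samp_prog s) (emits_in A) = ennreal (prod_list (map (avoid w A) xs))" .
  define W where "W = (\<Sum>i\<leftarrow>xs. w i)"
  show "expect (exec samp_prog s) (\<lambda>s. ennreal (exp (real (clock s))))
      \<le> ennreal (exp (14 + (10 + 3 * (exp 14 - 1)) * (\<Sum>i\<leftarrow>xs. w i)))"
    unfolding e expect_bind
  proof (rule expect_le[OF sl])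
    fix s' assume s': "half_done w xs s' \<and> clock s' \<le> 2 + 5 * length (large w xs) + 1"
    have "real (clock s') \<le> 3 + 5 * real (length (large w xs))" using s' by linarith
    also have "\<dots> \<le> 3 + 10 * W" using large_length[of xs w] w by (simp add: W_def)
    finally have 1: "real (clock s') \<le> 3 + 10 * W" .
    have "rvar s' 0 \<le> 3 * W" using s' by (simp add: half_done_def ready_def W_def)
    then have 2: "(exp 14 - 1) * rvar s' 0 \<le> (exp 14 - 1) * (3 * W)"
      by (intro mult_left_mono) simp_all
    have "expect (exec small_prog s') (\<lambda>s. ennreal (exp (real (clock s))))
        \<le> ennreal (exp (real (clock s') + 11 + (exp 14 - 1) * rvar s' 0))"
      using s' by (intro time_small_prog[of w xs]) simp
    also have "\<dots> \<le> ennreal (exp (14 + (10 + 3 * (exp 14 - 1)) * W))"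
      using 1 2 by (intro ennreal_leI) (simp add: algebra_simps)
    finally show "expect (exec small_prog s') (\<lambda>s. ennreal (exp (real (clock s))))
        \<le> ennreal (exp (14 + (10 + 3 * (exp 14 - 1)) * (\<Sum>i\<leftarrow>xs. w i)))" by (simp add: W_def)
  qed
qed

section \<open>Repeated calls on one PE\<close>

text \<open>Stamps and counter depend on the past, yet the downset probability of a call is the same
  from every \<open>ready\<close> state. Conditioning on the memory left behind thus yields a
  product, which makes the calls independent.\<close>

lemma rounds_samp_prog:
  assumes d: "distinct xs" and w: "\<And>i. i \<in> set xs \<Longrightarrow> 0 \<le> w i \<and> w i \<le> 1"
  shows sure_rounds: "ready w xs s \<Longrightarrow> sure (rounds samp_prog k s)
      (\<lambda>rs. \<forall>r<k. distinct (fst (rs ! r)) \<and> set (fst (rs ! r)) \<subseteq> set xs)"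
    and expect_rounds: "ready w xs s \<Longrightarrow> expect (rounds samp_prog k s) (\<lambda>rs. of_bool (\<forall>r<k. set (fst (rs ! r)) \<subseteq> A r))
      = ennreal (\<Prod>r<k. prod_list (map (avoid w (A r)) xs))"
    and time_rounds: "ready w xs s \<Longrightarrow> r < k \<Longrightarrow> expect (rounds samp_prog k s) (\<lambda>rs. ennreal (exp (real (snd (rs ! r)))))
      \<le> ennreal (exp (14 + (10 + 3 * (exp 14 - 1)) * (\<Sum>i\<leftarrow>xs. w i)))"
proof -
  have rd: "ready w xs (s\<lparr>emitted := [], clock := 0\<rparr>)" if "ready w xs s" for s
    using that by (simp add: ready_def tables_def)
  have sp: "sure (exec samp_prog (s\<lparr>emitted := [], clock := 0\<rparr>))
    (\<lambda>s'. ready w xs s' \<and> distinct (emitted s') \<and> set (emitted s') \<subseteq> set xs)" if "ready w xs s" for s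
    by (rule sure_samp_prog[OF rd[OF that] d w]) simp_all
  have sr: "sure (rounds samp_prog k s) (\<lambda>rs. \<forall>r<k. distinct (fst (rs ! r)) \<and> set (fst (rs ! r)) \<subseteq> set xs)"
    if "ready w xs s" for k s
    using that
  proof (induction k arbitrary: s)
    case (Suc k)
    show ?case
      unfolding rounds.simps sure_bind sure_map
      by (rule sure_mono[OF sp[OF Suc.prems]], rule sure_mono[OF Suc.IH]) (simp_all add: All_less_Suc2)
  qed simp
  show "ready w xs s \<Longrightarrow> sure (rounds samp_prog k s)
      (\<lambda>rs. \<forall>r<k. distinct (fst (rs ! r)) \<and> set (fst (rs ! r)) \<subseteq> set xs)" by (rule sr)
  show "ready w xs s \<Longrightarrow> expect (rounds samp_prog k s) (\<lambda>rs. of_bool (\<forall>r<k. set (fst (rs ! r)) \<subseteq> A r))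
      = ennreal (\<Prod>r<k. prod_list (map (avoid w (A r)) xs))"
  proof (induction k arbitrary: s A)
    case (Suc k)
    let ?p = "\<lambda>r. prod_list (map (avoid w (A r)) xs)"
    have p: "0 \<le> ?p r" for r using w by (intro prod_list_nonneg) (auto simp: avoid_def)
    have "expect (rounds samp_prog (Suc k) s) (\<lambda>rs. of_bool (\<forall>r<Suc k. set (fst (rs ! r)) \<subseteq> A r))
      = expect (exec samp_prog (s\<lparr>emitted := [], clock := 0\<rparr>))
          (\<lambda>s'. emits_in (A 0) s' * expect (rounds samp_prog k s') (\<lambda>rs. of_bool (\<forall>r<k. set (fst (rs ! r)) \<subseteq> A (Suc r))))"
      by (simp add: All_less_Suc2 of_bool_conj emits_in_def expect_cmult)
    also have "\<dots> = expect (exec samp_prog (s\<lparr>emitted := [], clock := 0\<rparr>))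
          (\<lambda>s'. emits_in (A 0) s' * ennreal (\<Prod>r<k. ?p (Suc r)))"
      by (rule expect_cong[OF sp[OF Suc.prems]]) (simp add: Suc.IH)
    also have "\<dots> = ennreal (?p 0) * ennreal (\<Prod>r<k. ?p (Suc r))"
      by (subst expect_multc, subst expect_samp_prog[OF rd[OF Suc.prems] d w]) simp_all
    also have "\<dots> = ennreal (\<Prod>r<Suc k. ?p r)"
      using p by (simp add: prod.lessThan_Suc_shift prod_nonneg ennreal_mult del: prod.lessThan_Suc)
    finally show ?case .
  qed simp
  show "ready w xs s \<Longrightarrow> r < k \<Longrightarrow> expect (rounds samp_prog k s) (\<lambda>rs. ennreal (exp (real (snd (rs ! r)))))
      \<le> ennreal (exp (14 + (10 + 3 * (exp 14 - 1)) * (\<Sum>i\<leftarrow>xs. w i)))"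
  proof (induction k arbitrary: s r)
    case (Suc k)
    show ?case
    proof (cases r)
      case 0
      have "expect (rounds samp_prog (Suc k) s) (\<lambda>rs. ennreal (exp (real (snd (rs ! r)))))
        = expect (exec samp_prog (s\<lparr>emitted := [], clock := 0\<rparr>)) (\<lambda>s'. ennreal (exp (real (clock s'))))"
        unfolding rounds.simps expect_bind expect_map
        by (rule expect_cong[OF sp[OF Suc.prems(1)]]) (simp add: 0 expect_const[OF sr])
      also have "\<dots> \<le> ennreal (exp (14 + (10 + 3 * (exp 14 - 1)) * (\<Sum>i\<leftarrow>xs. w i)))"
        by (rule time_samp_prog[OF rd[OF Suc.prems(1)] d w]) simp_all
      finally show ?thesis .
    next
      case (Suc r')
      then have r': "r' < k" using Suc.prems(2) by simp
      show ?thesis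
        unfolding rounds.simps expect_bind expect_map \<open>r = Suc r'\<close> nth_Cons_Suc
        by (rule expect_le[OF sp[OF Suc.prems(1)]], rule Suc.IH[OF _ r']) simp
    qed
  qed simp
qed

lemma run_pe:
  assumes d: "distinct xs" and w: "\<And>i. i \<in> set xs \<Longrightarrow> 0 \<le> w i \<and> w i \<le> 1"
  shows sure_run_pe: "sure (run_pe prep_prog samp_prog k w xs) (\<lambda>x. fst x \<le> 27 * length xs + 5
      \<and> (\<forall>r<k. distinct (round_output r x) \<and> set (round_output r x) \<subseteq> set xs))"
    and expect_run_pe: "expect (run_pe prep_prog samp_prog k w xs) (\<lambda>x. of_bool (\<forall>r<k. set (round_output r x) \<subseteq> A r))
      = ennreal (\<Prod>r<k. \<Prod>i\<in>set xs. avoid w (A r) i)"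
    and time_run_pe: "r < k \<Longrightarrow> expect (run_pe prep_prog samp_prog k w xs) (\<lambda>x. ennreal (exp (real (snd (snd x ! r)))))
      \<le> ennreal (exp (14 + (10 + 3 * (exp 14 - 1)) * (\<Sum>i\<leftarrow>xs. w i)))"
proof -
  have sp: "sure (exec prep_prog (initial_state w xs)) (\<lambda>s. ready w xs s \<and> clock s \<le> 27 * length xs + 5)"
    using w by (intro sure_prep_prog) auto
  show "sure (run_pe prep_prog samp_prog k w xs) (\<lambda>x. fst x \<le> 27 * length xs + 5
      \<and> (\<forall>r<k. distinct (round_output r x) \<and> set (round_output r x) \<subseteq> set xs))"
    unfolding run_pe_def sure_bind sure_map round_output_def
    by (rule sure_mono[OF sp], rule sure_mono[OF sure_rounds[OF d w]]) auto
  show "expect (run_pe prep_prog samp_prog k w xs) (\<lambda>x. of_bool (\<forall>r<k. set (round_output r x) \<subseteq> A r))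
      = ennreal (\<Prod>r<k. \<Prod>i\<in>set xs. avoid w (A r) i)"
  proof -
    have "expect (run_pe prep_prog samp_prog k w xs) (\<lambda>x. of_bool (\<forall>r<k. set (round_output r x) \<subseteq> A r))
      = expect (exec prep_prog (initial_state w xs)) (\<lambda>_. ennreal (\<Prod>r<k. prod_list (map (avoid w (A r)) xs)))"
      unfolding run_pe_def expect_bind expect_map round_output_def
      by (rule expect_cong[OF sp]) (simp add: expect_rounds[OF d w])
    then show ?thesis by (simp add: expect_const[OF sp] prod.distinct_set_conv_list d)
  qed
  show "r < k \<Longrightarrow> expect (run_pe prep_prog samp_prog k w xs) (\<lambda>x. ennreal (exp (real (snd (snd x ! r)))))
      \<le> ennreal (exp (14 + (10 + 3 * (exp 14 - 1)) * (\<Sum>i\<leftarrow>xs. w i)))"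
    unfolding run_pe_def expect_bind expect_map snd_conv
    by (rule expect_le[OF sp], rule time_rounds[OF d w]) auto
qed

section \<open>The parallel machine\<close>

lemma sure_parallel:
  assumes "\<And>q. q < p \<Longrightarrow> sure (R q) (Q q)"
  shows "sure (parallel p R) (\<lambda>x. \<forall>q<p. Q q (x q))"
proof -
  have "x q \<noteq> None \<and> Q q (the (x q))" if "x \<in> set_pmf (Pi_pmf {..<p} None R)" "q < p" for x q
  proof -
    have "x q \<in> set_pmf (R q)"
      using that set_Pi_pmf_subset'[of "{..<p}" None R] by (auto simp: PiE_dflt_def)
    then show ?thesis using assms[OF that(2)] by (auto simp: sure_def split: option.splits)
  qed
  then show ?thesis by (auto simp: sure_def parallel_def)
qed

text \<open>Counting divergence as 0 makes the product vanish as soon as one PE diverges, which is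
  the convention of \<open>parallel\<close>; independence does the rest.\<close>

lemma expect_parallel_prod:
  "expect (parallel p R) (\<lambda>x. \<Prod>q<p. g q (x q)) = (\<Prod>q<p. expect (R q) (g q))"
proof -
  have "expect (parallel p R) (\<lambda>x. \<Prod>q<p. g q (x q))
    = (\<integral>\<^sup>+ x. (\<Prod>q<p. case x q of None \<Rightarrow> 0 | Some y \<Rightarrow> g q y) \<partial>measure_pmf (Pi_pmf {..<p} None R))"
    unfolding expect_def parallel_def nn_integral_map_pmf
  proof (intro nn_integral_cong)
    fix x :: "nat \<Rightarrow> 'a option"
    show "(case if \<forall>q<p. x q \<noteq> None then Some (\<lambda>q. the (x q)) else None of None \<Rightarrow> 0
        | Some x \<Rightarrow> \<Prod>q<p. g q (x q)) = (\<Prod>q<p. case x q of None \<Rightarrow> 0 | Some y \<Rightarrow> g q y)"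
    proof (cases "\<forall>q<p. x q \<noteq> None")
      case True
      then show ?thesis by (auto intro!: prod.cong split: option.splits)
    next
      case False
      then show ?thesis by (auto intro!: prod_zero[symmetric] bexI)
    qed
  qed
  also have "\<dots> = (\<Prod>q<p. expect (R q) (g q))"
    unfolding expect_def by (rule nn_integral_prod_Pi_pmf) simp
  finally show ?thesis .
qed

text \<open>Only an inequality, because divergence of another PE removes mass from the joint run;
  upper bounds on time need no more.\<close>

lemma expect_parallel_component:
  assumes "q < p"
  shows "expect (parallel p R) (\<lambda>x. g (x q)) \<le> expect (R q) g"
proof -
  have "expect (parallel p R) (\<lambda>x. g (x q))
      \<le> (\<integral>\<^sup>+ x. (case x q of None \<Rightarrow> 0 | Some y \<Rightarrow> g y) \<partial>measure_pmf (Pi_pmf {..<p} None R))"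
    unfolding expect_def parallel_def nn_integral_map_pmf
    using assms by (intro nn_integral_mono) (auto split: option.splits)
  also have "\<dots> = (\<integral>\<^sup>+ r. (case r of None \<Rightarrow> 0 | Some y \<Rightarrow> g y)
      \<partial>measure_pmf (map_pmf (\<lambda>x. x q) (Pi_pmf {..<p} None R)))"
    by simp
  also have "\<dots> = expect (R q) g"
    using assms by (simp only: Pi_pmf_component finite_lessThan) (simp add: expect_def)
  finally show ?thesis .
qed

section \<open>The joint law of the samples\<close>

lemma of_bool_all_less: "of_bool (\<forall>q<p. P q) = (\<Prod>q<p. of_bool (P q) :: ennreal)" for p :: nat
  by (induction p) (simp_all add: All_less_Suc of_bool_conj mult.commute)

lemma nn_integral_subset_pmf:
  assumes "\<And>i. i < n \<Longrightarrow> 0 \<le> w i \<and> w i \<le> 1"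
  shows "(\<integral>\<^sup>+ S. of_bool (S \<subseteq> A) \<partial>measure_pmf (subset_pmf n w)) = ennreal (\<Prod>i<n. avoid w A i)"
proof -
  have "(\<integral>\<^sup>+ S. of_bool (S \<subseteq> A) \<partial>measure_pmf (subset_pmf n w))
      = (\<integral>\<^sup>+ x. (\<Prod>i<n. of_bool (x i \<longrightarrow> i \<in> A)) \<partial>measure_pmf (Pi_pmf {..<n} False (\<lambda>i. bernoulli_pmf (w i))))"
    unfolding subset_pmf_def nn_integral_map_pmf
    by (intro nn_integral_cong) (simp add: subset_eq flip: of_bool_all_less)
  also have "\<dots> = (\<Prod>i<n. \<integral>\<^sup>+ h. of_bool (h \<longrightarrow> i \<in> A) \<partial>measure_pmf (bernoulli_pmf (w i)))"
    by (rule nn_integral_prod_Pi_pmf) simp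
  also have "\<dots> = (\<Prod>i<n. ennreal (avoid w A i))"
    using assms by (intro prod.cong) (auto simp: avoid_def simp flip: ennreal_plus)
  also have "\<dots> = ennreal (\<Prod>i<n. avoid w A i)"
    using assms by (intro prod_ennreal) (auto simp: avoid_def)
  finally show ?thesis .
qed

lemma nn_integral_replicate_pmf:
  fixes P :: "'a set pmf"
  shows "(\<integral>\<^sup>+ l. of_bool (\<forall>r<k. l ! r \<subseteq> A r) \<partial>measure_pmf (replicate_pmf k P))
    = (\<Prod>r<k. \<integral>\<^sup>+ S. of_bool (S \<subseteq> A r) \<partial>measure_pmf P)"
proof (induction k arbitrary: A)
  case (Suc k)
  have "(\<integral>\<^sup>+ l. of_bool (\<forall>r<Suc k. l ! r \<subseteq> A r) \<partial>measure_pmf (replicate_pmf (Suc k) P))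
      = (\<integral>\<^sup>+ S. of_bool (S \<subseteq> A 0) * (\<integral>\<^sup>+ l. of_bool (\<forall>r<k. l ! r \<subseteq> A (Suc r)) \<partial>measure_pmf (replicate_pmf k P)) \<partial>measure_pmf P)"
    by (simp add: All_less_Suc2 of_bool_conj nn_integral_cmult)
  then show ?case
    by (simp add: Suc.IH nn_integral_multc prod.lessThan_Suc_shift del: prod.lessThan_Suc)
qed simp

text \<open>A list of \<open>k\<close> subsets of \<open>U\<close> is one subset of
  \<open>{..<k} \<times> U\<close>. A downset event of the encoding prescribes a separate bound for
  each call, so the inversion applies to the joint law.\<close>

lemma set_list_spmf_eqI:
  fixes D E :: "'a set list spmf"
  assumes U: "finite U"
    and D: "sure D (\<lambda>l. length l = k \<and> (\<forall>r<k. l ! r \<subseteq> U))" and E: "sure E (\<lambda>l. length l = k \<and> (\<forall>r<k. l ! r \<subseteq> U))"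
    and eq: "\<And>A. expect D (\<lambda>l. of_bool (\<forall>r<k. l ! r \<subseteq> A r)) = expect E (\<lambda>l. of_bool (\<forall>r<k. l ! r \<subseteq> A r))"
  shows "D = E"
proof -
  define enc :: "'a set list option \<Rightarrow> (nat \<times> 'a) set" where
    "enc x = {(r, i). r < k \<and> i \<in> the x ! r}" for x
  define dec :: "(nat \<times> 'a) set \<Rightarrow> 'a set list option" where
    "dec S = Some (map (\<lambda>r. {i. (r, i) \<in> S}) [0..<k])" for S
  have dec: "map_pmf dec (map_pmf enc F) = F" if "sure F (\<lambda>l. length l = k \<and> (\<forall>r<k. l ! r \<subseteq> U))" for F
  proof -
    have "dec (enc x) = x" if x: "x \<in> set_pmf F" for x
    proof -
      obtain l where l: "x = Some l" "length l = k"
        using x \<open>sure F _\<close> by (auto simp: sure_def split: option.splits)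
      then show ?thesis by (auto simp: dec_def enc_def intro!: nth_equalityI)
    qed
    then have "map_pmf (dec \<circ> enc) F = map_pmf id F" by (intro map_pmf_cong) auto
    then show ?thesis by (simp add: pmf.map_comp)
  qed
  have sub: "set_pmf (map_pmf enc F) \<subseteq> Pow ({..<k} \<times> U)"
    if "sure F (\<lambda>l. length l = k \<and> (\<forall>r<k. l ! r \<subseteq> U))" for F
    using that by (fastforce simp: enc_def sure_def split: option.splits)
  have prob: "ennreal (measure_pmf.prob (map_pmf enc F) {B. B \<subseteq> A})
      = expect F (\<lambda>l. of_bool (\<forall>r<k. l ! r \<subseteq> {i. (r, i) \<in> A}))"
    if "sure F (\<lambda>l. length l = k \<and> (\<forall>r<k. l ! r \<subseteq> U))" for F A
  proof -
    have "ennreal (measure_pmf.prob (map_pmf enc F) {B. B \<subseteq> A})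
        = (\<integral>\<^sup>+ B. indicator {B. B \<subseteq> A} B \<partial>measure_pmf (map_pmf enc F))"
      by (simp only: nn_integral_indicator sets_measure_pmf UNIV_I measure_pmf.emeasure_eq_measure)
    also have "\<dots> = expect F (\<lambda>l. of_bool (\<forall>r<k. l ! r \<subseteq> {i. (r, i) \<in> A}))"
      unfolding expect_def nn_integral_map_pmf using that
      by (intro nn_integral_cong_AE)
        (auto simp: AE_measure_pmf_iff sure_def enc_def indicator_def split: option.splits)
    finally show ?thesis .
  qed
  have "map_pmf enc D = map_pmf enc E"
  proof (rule pmf_eqI_subset_prob[where U = "{..<k} \<times> U"])
    fix A :: "(nat \<times> 'a) set"
    have "ennreal (measure_pmf.prob (map_pmf enc D) {B. B \<subseteq> A}) = ennreal (measure_pmf.prob (map_pmf enc E) {B. B \<subseteq> A})"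
      by (simp only: prob D E eq)
    then show "measure_pmf.prob (map_pmf enc D) {B. B \<subseteq> A} = measure_pmf.prob (map_pmf enc E) {B. B \<subseteq> A}"
      by simp
  qed (use U sub D E in auto)
  then show ?thesis using dec[OF D] dec[OF E] by metis
qed

lemma local_items: "distinct (local_items n f q)" "set (local_items n f q) = {i \<in> {..<n}. f i = q}"
  by (auto simp: local_items_def)

lemma weighted_subset_sampler_progs:
  assumes w: "\<And>i. i < n \<Longrightarrow> 0 \<le> w i \<and> w i \<le> 1"
  shows "weighted_subset_sampler prep_prog samp_prog n w p"
  unfolding weighted_subset_sampler_def
proof (intro allI impI)
  fix f :: "nat \<Rightarrow> nat" and k :: nat
  assume f: "\<forall>i<n. f i < p"
  let ?M = "run_machine prep_prog samp_prog k n w p f"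
  let ?R = "\<lambda>q. run_pe prep_prog samp_prog k w (local_items n f q)"
  have wl: "0 \<le> w i \<and> w i \<le> 1" if "i \<in> set (local_items n f q)" for i q
    using that w by (auto simp: local_items)
  have sM: "sure ?M (\<lambda>x. \<forall>q<p. \<forall>r<k. distinct (round_output r (x q))
      \<and> set (round_output r (x q)) \<subseteq> set (local_items n f q))"
    unfolding run_machine_def
    by (rule sure_parallel, rule sure_mono[OF sure_run_pe[OF local_items(1) wl]]) auto
  have "map_spmf (\<lambda>x. map (\<lambda>r. sample p r x) [0..<k]) ?M = spmf_of_pmf (replicate_pmf k (subset_pmf n w))"
  proof (rule set_list_spmf_eqI[where U = "{..<n}"])
    show "sure (map_spmf (\<lambda>x. map (\<lambda>r. sample p r x) [0..<k]) ?M) (\<lambda>l. length l = k \<and> (\<forall>r<k. l ! r \<subseteq> {..<n}))"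
      unfolding sure_map by (rule sure_mono[OF sM]) (fastforce simp: sample_def local_items)
    show "sure (spmf_of_pmf (replicate_pmf k (subset_pmf n w))) (\<lambda>l. length l = k \<and> (\<forall>r<k. l ! r \<subseteq> {..<n}))"
      by (fastforce simp: set_replicate_pmf subset_pmf_def dest!: nth_mem)
    fix A :: "nat \<Rightarrow> nat set"
    have "expect (map_spmf (\<lambda>x. map (\<lambda>r. sample p r x) [0..<k]) ?M) (\<lambda>l. of_bool (\<forall>r<k. l ! r \<subseteq> A r))
        = expect ?M (\<lambda>x. \<Prod>q<p. of_bool (\<forall>r<k. set (round_output r (x q)) \<subseteq> A r))"
      unfolding expect_map
      by (rule expect_cong[OF sM]) (force simp: sample_def simp flip: of_bool_all_less intro!: arg_cong[where f = of_bool])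
    also have "\<dots> = (\<Prod>q<p. ennreal (\<Prod>r<k. \<Prod>i\<in>set (local_items n f q). avoid w (A r) i))"
      unfolding run_machine_def
      by (simp only: expect_parallel_prod[where g = "\<lambda>_ x. of_bool (\<forall>r<k. set (round_output r x) \<subseteq> A r)"]
          expect_run_pe[OF local_items(1) wl])
    also have "\<dots> = ennreal (\<Prod>q<p. \<Prod>r<k. \<Prod>i\<in>set (local_items n f q). avoid w (A r) i)"
      using wl by (intro prod_ennreal prod_nonneg) (auto simp: avoid_def)
    \<comment> \<open>The placement puts each item on exactly one of the \<open>p\<close> PEs, so
      the local products regroup into one over all items.\<close>
    also have "(\<Prod>q<p. \<Prod>r<k. \<Prod>i\<in>set (local_items n f q). avoid w (A r) i) = (\<Prod>r<k. \<Prod>i<n. avoid w (A r) i)"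
      unfolding local_items using f
      by (subst prod.swap) (intro prod.cong refl prod.group; auto)
    also have "ennreal \<dots> = expect (spmf_of_pmf (replicate_pmf k (subset_pmf n w))) (\<lambda>l. of_bool (\<forall>r<k. l ! r \<subseteq> A r))"
      using w by (simp add: nn_integral_replicate_pmf nn_integral_subset_pmf)
        (intro prod_ennreal[symmetric] prod_nonneg, auto simp: avoid_def)
    finally show "expect (map_spmf (\<lambda>x. map (\<lambda>r. sample p r x) [0..<k]) ?M) (\<lambda>l. of_bool (\<forall>r<k. l ! r \<subseteq> A r))
        = expect (spmf_of_pmf (replicate_pmf k (subset_pmf n w))) (\<lambda>l. of_bool (\<forall>r<k. l ! r \<subseteq> A r))" .
  qed simp
  moreover have "\<forall>x\<in>set_spmf ?M. \<forall>r<k. \<forall>q<p. distinct (round_output r (x q))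
      \<and> set (round_output r (x q)) \<subseteq> set (local_items n f q)"
    using sure_set_spmf[OF sM] by blast
  ultimately show "map_spmf (\<lambda>x. map (\<lambda>r. sample p r x) [0..<k]) ?M
      = spmf_of_pmf (replicate_pmf k (subset_pmf n w))
    \<and> (\<forall>x\<in>set_spmf ?M. \<forall>r<k. \<forall>q<p. distinct (round_output r (x q))
      \<and> set (round_output r (x q)) \<subseteq> set (local_items n f q))" ..
qed

section \<open>The slowest PE under random placement\<close>

text \<open>The load is a sum of independent terms, item \<open>i\<close> contributing
  \<open>v i\<close> with probability \<open>1 / p\<close>. The bound \<open>v i \<le> 1\<close>
  permits the chord of \<open>exp\<close> between 0 and \<open>\<kappa>\<close>, and
  \<open>1 + x \<le> exp x\<close> then collects the factors.\<close>

lemma exp_load: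
  assumes p: "1 \<le> p" "q < p" and v: "\<And>i. i < n \<Longrightarrow> 0 \<le> v i \<and> v i \<le> 1" and "0 \<le> \<kappa>"
  shows "(\<integral>\<^sup>+ f. ennreal (exp (\<kappa> * (\<Sum>i\<leftarrow>local_items n f q. v i))) \<partial>measure_pmf (random_placement n p))
    \<le> ennreal (exp ((exp \<kappa> - 1) * (\<Sum>i<n. v i) / real p))"
proof -
  have "exp (\<kappa> * (\<Sum>i\<leftarrow>local_items n f q. v i)) = (\<Prod>i<n. if f i = q then exp (\<kappa> * v i) else 1)" for f
  proof -
    have "(\<Sum>i\<leftarrow>local_items n f q. v i) = (\<Sum>i\<in>{i\<in>{..<n}. f i = q}. v i)"
      using sum.distinct_set_conv_list[OF local_items(1), of v n f q] by (simp add: local_items)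
    also have "\<dots> = (\<Sum>i<n. if f i = q then v i else 0)" by (intro sum.inter_filter) simp
    finally show ?thesis by (auto simp: sum_distrib_left exp_sum intro!: prod.cong)
  qed
  then have "(\<integral>\<^sup>+ f. ennreal (exp (\<kappa> * (\<Sum>i\<leftarrow>local_items n f q. v i))) \<partial>measure_pmf (random_placement n p))
      = (\<integral>\<^sup>+ f. (\<Prod>i<n. ennreal (if f i = q then exp (\<kappa> * v i) else 1)) \<partial>measure_pmf (random_placement n p))"
    by (intro nn_integral_cong) (simp only:, intro prod_ennreal[symmetric], auto)
  also have "\<dots> = (\<Prod>i<n. \<integral>\<^sup>+ y. ennreal (if y = q then exp (\<kappa> * v i) else 1) \<partial>measure_pmf (pmf_of_set {..<p}))"
    unfolding random_placement_def by (rule nn_integral_prod_Pi_pmf) simp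
  also have "\<dots> \<le> (\<Prod>i<n. ennreal (exp ((exp \<kappa> - 1) * v i / real p)))"
  proof (intro prod_mono_ennreal)
    fix i assume "i \<in> {..<n}"
    then have vi: "0 \<le> v i" "v i \<le> 1" using v by auto
    have "(\<integral>\<^sup>+ y. ennreal (if y = q then exp (\<kappa> * v i) else 1) \<partial>measure_pmf (pmf_of_set {..<p}))
        = ennreal ((\<Sum>y<p. if y = q then exp (\<kappa> * v i) else 1) / real p)"
      using p by (subst nn_integral_pmf_of_set)
        (auto simp: lessThan_empty_iff ennreal_of_nat_eq_real_of_nat sum_nonneg sum_ennreal simp flip: divide_ennreal)
    also have "(\<Sum>y<p. if y = q then exp (\<kappa> * v i) else 1) = exp (\<kappa> * v i) - 1 + real p"
    proof -
      have "(\<Sum>y<p. if y = q then exp (\<kappa> * v i) else 1) = (\<Sum>y<p. (if y = q then exp (\<kappa> * v i) - 1 else 0) + 1)"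
        by (intro sum.cong) auto
      then show ?thesis using p by (simp add: sum.distrib)
    qed
    also have "(exp (\<kappa> * v i) - 1 + real p) / real p = 1 + (exp (\<kappa> * v i) - 1) / real p"
      using p by (simp add: field_simps)
    also have "ennreal \<dots> \<le> ennreal (exp ((exp \<kappa> - 1) * v i / real p))"
    proof (rule ennreal_leI)
      have "exp ((1 - v i) *\<^sub>R 0 + v i *\<^sub>R \<kappa>) \<le> (1 - v i) * exp 0 + v i * exp \<kappa>"
        using vi by (intro convex_onD[OF exp_convex]) auto
      then have "exp (\<kappa> * v i) - 1 \<le> (exp \<kappa> - 1) * v i" by (simp add: algebra_simps)
      then have "(exp (\<kappa> * v i) - 1) / real p \<le> (exp \<kappa> - 1) * v i / real p" by (intro divide_right_mono) auto
      then show "1 + (exp (\<kappa> * v i) - 1) / real p \<le> exp ((exp \<kappa> - 1) * v i / real p)"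
        using exp_ge_add_one_self[of "(exp \<kappa> - 1) * v i / real p"] by linarith
    qed
    finally show "(\<integral>\<^sup>+ y. ennreal (if y = q then exp (\<kappa> * v i) else 1) \<partial>measure_pmf (pmf_of_set {..<p}))
      \<le> ennreal (exp ((exp \<kappa> - 1) * v i / real p))" .
  qed
  also have "\<dots> = ennreal (exp ((exp \<kappa> - 1) * (\<Sum>i<n. v i) / real p))"
    by (simp add: prod_ennreal exp_sum[symmetric] sum_distrib_left sum_divide_distrib)
  finally show ?thesis .
qed

text \<open>
  Exponential moments turn the maximum over the PEs into a sum: for every \<open>c\<close>, the maximum is at most
  \<open>c + (\<Sum>q<p. exp (T\<^sub>q - c))\<close>, and \<open>c\<close> is chosen such that the sum has mean at most 1.
\<close>

lemma expected_time_slowest: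
  assumes p: "1 \<le> p" and v: "\<And>i. i < n \<Longrightarrow> 0 \<le> v i \<and> v i \<le> 1" and "0 \<le> \<kappa>" "0 \<le> b"
    and sR: "\<And>f q. sure (R f q) (Q f q)"
    and R: "\<And>f q. q < p \<Longrightarrow> expect (R f q) (\<lambda>x. ennreal (exp (real (T x))))
      \<le> ennreal (exp (b + \<kappa> * (\<Sum>i\<leftarrow>local_items n f q. v i)))"
  shows "expected_time (\<lambda>x. Max ((\<lambda>q. T (x q)) ` {..<p})) (bind_pmf (random_placement n p) (\<lambda>f. parallel p (R f)))
    \<le> ennreal (b + ln (real p) + (exp \<kappa> - 1) * (\<Sum>i<n. v i) / real p + 1)"
proof -
  define V where "V = (exp \<kappa> - 1) * (\<Sum>i<n. v i) / real p"
  \<comment> \<open>\<open>b + V\<close> bounds the exponent of each single moment after averaging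
    over placements, and \<open>ln (real p)\<close> pays for summing \<open>p\<close> of
    them.\<close>
  define c where "c = b + ln (real p) + V"
  have V: "0 \<le> V" unfolding V_def using v \<open>0 \<le> \<kappa>\<close>
    by (intro divide_nonneg_nonneg mult_nonneg_nonneg sum_nonneg) auto
  have c: "0 \<le> c" using V p \<open>0 \<le> b\<close> by (simp add: c_def)
  have mx: "of_nat (Max ((\<lambda>q. T (x q)) ` {..<p})) \<le> ennreal c + ennreal (exp (- c)) * (\<Sum>q<p. ennreal (exp (real (T (x q)))))"
    for x
  proof -
    have "Max ((\<lambda>q. T (x q)) ` {..<p}) \<in> (\<lambda>q. T (x q)) ` {..<p}"
      using p by (intro Max_in) (auto simp: lessThan_empty_iff)
    then obtain q where q: "q < p" "Max ((\<lambda>q. T (x q)) ` {..<p}) = T (x q)" by auto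
    have "exp (- c) * exp (real (T (x q))) = exp (real (T (x q)) - c)" by (simp flip: exp_add)
    then have "real (T (x q)) \<le> c + exp (- c) * exp (real (T (x q)))"
      using exp_ge_add_one_self[of "real (T (x q)) - c"] by linarith
    also have "exp (real (T (x q))) \<le> (\<Sum>q<p. exp (real (T (x q))))"
      using q by (intro member_le_sum) auto
    finally have "real (T (x q)) \<le> c + exp (- c) * (\<Sum>q<p. exp (real (T (x q))))" by simp
    then have "ennreal (real (T (x q))) \<le> ennreal (c + exp (- c) * (\<Sum>q<p. exp (real (T (x q)))))"
      by (rule ennreal_leI)
    also have "\<dots> = ennreal c + ennreal (exp (- c)) * (\<Sum>q<p. ennreal (exp (real (T (x q)))))"
      using c by (simp add: ennreal_mult sum_nonneg sum_ennreal)
    finally show ?thesis by (simp add: q ennreal_of_nat_eq_real_of_nat)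
  qed
  have "expected_time (\<lambda>x. Max ((\<lambda>q. T (x q)) ` {..<p})) (bind_pmf (random_placement n p) (\<lambda>f. parallel p (R f)))
    = (\<integral>\<^sup>+ f. expect (parallel p (R f)) (\<lambda>x. of_nat (Max ((\<lambda>q. T (x q)) ` {..<p}))) \<partial>measure_pmf (random_placement n p))"
    unfolding expected_time_def nn_integral_bind_pmf
    by (intro nn_integral_cong expect_top_conv[OF sure_parallel]) (rule sR)
  also have "\<dots> \<le> (\<integral>\<^sup>+ f. ennreal c + ennreal (exp (- c)) * (\<Sum>q<p. ennreal (exp b)
      * ennreal (exp (\<kappa> * (\<Sum>i\<leftarrow>local_items n f q. v i)))) \<partial>measure_pmf (random_placement n p))"
  proof (rule nn_integral_mono)
    fix f
    have "expect (parallel p (R f)) (\<lambda>x. of_nat (Max ((\<lambda>q. T (x q)) ` {..<p})))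
        \<le> expect (parallel p (R f)) (\<lambda>x. ennreal c + ennreal (exp (- c)) * (\<Sum>q<p. ennreal (exp (real (T (x q))))))"
      by (rule expect_mono') (rule mx)
    also have "\<dots> = ennreal c + ennreal (exp (- c)) * (\<Sum>q<p. expect (parallel p (R f)) (\<lambda>x. ennreal (exp (real (T (x q))))))"
      using expect_const[OF sure_parallel[of p "R f" "Q f"], of "ennreal c"] sR
      by (simp add: expect_add expect_cmult expect_sum del: sum_ennreal)
    also have "\<dots> \<le> ennreal c + ennreal (exp (- c)) * (\<Sum>q<p. ennreal (exp b)
      * ennreal (exp (\<kappa> * (\<Sum>i\<leftarrow>local_items n f q. v i))))"
    proof (intro add_left_mono mult_left_mono sum_mono)
      fix q assume "q \<in> {..<p}"
      then have "expect (parallel p (R f)) (\<lambda>x. ennreal (exp (real (T (x q)))))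
          \<le> ennreal (exp (b + \<kappa> * (\<Sum>i\<leftarrow>local_items n f q. v i)))"
        using expect_parallel_component[of q p "R f" "\<lambda>x. ennreal (exp (real (T x)))"] R[of q f] by auto
      then show "expect (parallel p (R f)) (\<lambda>x. ennreal (exp (real (T (x q)))))
        \<le> ennreal (exp b) * ennreal (exp (\<kappa> * (\<Sum>i\<leftarrow>local_items n f q. v i)))"
        by (simp add: exp_add ennreal_mult)
    qed simp
    finally show "expect (parallel p (R f)) (\<lambda>x. of_nat (Max ((\<lambda>q. T (x q)) ` {..<p})))
      \<le> ennreal c + ennreal (exp (- c)) * (\<Sum>q<p. ennreal (exp b)
      * ennreal (exp (\<kappa> * (\<Sum>i\<leftarrow>local_items n f q. v i))))" .
  qed
  also have "\<dots> = ennreal c + ennreal (exp (- c)) * (\<Sum>q<p. ennreal (exp b)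
      * (\<integral>\<^sup>+ f. ennreal (exp (\<kappa> * (\<Sum>i\<leftarrow>local_items n f q. v i))) \<partial>measure_pmf (random_placement n p)))"
    by (simp add: nn_integral_add nn_integral_cmult nn_integral_sum)
  also have "\<dots> \<le> ennreal c + ennreal (exp (- c)) * (\<Sum>q<p. ennreal (exp b) * ennreal (exp V))"
    unfolding V_def using p v \<open>0 \<le> \<kappa>\<close>
    by (intro add_left_mono mult_left_mono sum_mono exp_load) auto
  also have "\<dots> = ennreal (c + exp (- c) * (real p * (exp b * exp V)))"
    using c by (simp add: ennreal_mult ennreal_of_nat_eq_real_of_nat)
  also have "exp (- c) * (real p * (exp b * exp V)) = 1"
  proof -
    have "real p * (exp b * exp V) = exp c" using p by (simp add: c_def exp_add)
    then show ?thesis by (simp flip: exp_add)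
  qed
  finally show ?thesis by (simp add: c_def V_def)
qed

text \<open>The 1 beside the logarithm absorbs the additive constants, which remain when
  \<open>p = 1\<close>.\<close>

lemma time_bound_arith:
  fixes V :: real
  assumes "1 \<le> p" "0 \<le> V" "b + 1 + exp \<kappa> \<le> C" "0 \<le> b"
  shows "b + ln (real p) + (exp \<kappa> - 1) * V / real p + 1 \<le> C * (V / real p + (1 + log 2 (real p)))"
proof -
  have "ln (2::real) \<le> 1" using ln_le_minus_one[of "2::real"] by simp
  then have "ln (real p) \<le> log 2 (real p)"
    using assms(1) mult_left_mono[of "ln 2" 1 "ln (real p)"] by (simp add: log_def divide_simps)
  moreover have "1 * log 2 (real p) \<le> C * log 2 (real p)"
    using assms by (intro mult_right_mono) (auto intro: order_trans[of _ "b + 1 + exp \<kappa>"])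
  moreover have "(exp \<kappa> - 1) * (V / real p) \<le> C * (V / real p)"
    using assms by (intro mult_right_mono) auto
  moreover have "b + 1 \<le> C" using assms exp_ge_zero[of \<kappa>] by linarith
  ultimately show ?thesis by (simp add: distrib_left)
qed

theorem theorem16:
  shows "\<exists>(prep :: com) (samp :: com) (C :: real). C > 0 \<and>
    (\<forall>(n :: nat) (w :: nat \<Rightarrow> real) (p :: nat).
      p \<ge> 1 \<longrightarrow> (\<forall>i<n. 0 \<le> w i \<and> w i \<le> 1) \<longrightarrow>
        weighted_subset_sampler prep samp n w p
        \<and> (\<forall>k. expected_time (prep_time p) (random_run prep samp k n w p)
              \<le> ennreal (C * (real n / real p + (1 + log 2 (real p)))))
        \<and> (\<forall>k. \<forall>r<k. expected_time (sampling_time p r) (random_run prep samp k n w p)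
              \<le> ennreal (C * ((\<Sum>i<n. w i) / real p + (1 + log 2 (real p))))))"
proof -
  \<comment> \<open>The coefficient of the local weight in \<open>time_samp_prog\<close>.
    \<open>C\<close> then covers both uses of \<open>time_bound_arith\<close>: 5 and 27 for
    preprocessing, 14 and \<open>\<kappa>\<close> for sampling.\<close>
  define \<kappa> :: real where "\<kappa> = 10 + 3 * (exp 14 - 1)"
  define C :: real where "C = 15 + exp 27 + exp \<kappa>"
  have \<kappa>: "0 \<le> \<kappa>" by (simp add: \<kappa>_def)
  have C: "5 + 1 + exp 27 \<le> C" "14 + 1 + exp \<kappa> \<le> C" "0 < C"
    by (simp_all add: C_def add_pos_pos)
  show ?thesis
  proof (rule exI[of _ prep_prog], rule exI[of _ samp_prog], rule exI[of _ C], intro conjI allI impI C(3))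
    fix n :: nat and w :: "nat \<Rightarrow> real" and p :: nat
    assume p: "1 \<le> p" and w: "\<forall>i<n. 0 \<le> w i \<and> w i \<le> 1"
    show "weighted_subset_sampler prep_prog samp_prog n w p"
      using w by (intro weighted_subset_sampler_progs) auto
    have wl: "0 \<le> w i \<and> w i \<le> 1" if "i \<in> set (local_items n f q)" for i f q
      using that w by (auto simp: local_items)
    have run: "random_run prep_prog samp_prog k n w p = bind_pmf (random_placement n p)
      (\<lambda>f. parallel p (\<lambda>q. run_pe prep_prog samp_prog k w (local_items n f q)))" for k
      by (simp add: random_run_def run_machine_def[abs_def])
    note sR = sure_run_pe[OF local_items(1) wl]
    show "expected_time (prep_time p) (random_run prep_prog samp_prog k n w p)
        \<le> ennreal (C * (real n / real p + (1 + log 2 (real p))))" for k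
    proof -
      \<comment> \<open>Weights \<open>v i = 1\<close> turn the load into the number of local items,
        in which preprocessing time is linear.\<close>
      have "expected_time (prep_time p) (random_run prep_prog samp_prog k n w p)
          \<le> ennreal (5 + ln (real p) + (exp 27 - 1) * (\<Sum>i<n. 1) / real p + 1)"
        unfolding run prep_time_def[abs_def]
      proof (rule expected_time_slowest[OF p _ _ _ sR])
        fix f q
        show "expect (run_pe prep_prog samp_prog k w (local_items n f q)) (\<lambda>x. ennreal (exp (real (fst x))))
            \<le> ennreal (exp (5 + 27 * (\<Sum>i\<leftarrow>local_items n f q. 1)))"
        proof (rule expect_le[OF sR])
          fix x assume "fst x \<le> 27 * length (local_items n f q) + 5
            \<and> (\<forall>r<k. distinct (round_output r x) \<and> set (round_output r x) \<subseteq> set (local_items n f q))"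
          then have "real (fst x) \<le> 5 + 27 * real (length (local_items n f q))" by linarith
          then show "ennreal (exp (real (fst x))) \<le> ennreal (exp (5 + 27 * (\<Sum>i\<leftarrow>local_items n f q. 1)))"
            by (intro ennreal_leI) (simp add: sum_list_triv)
        qed
      qed simp_all
      also have "\<dots> \<le> ennreal (C * (real n / real p + (1 + log 2 (real p))))"
        using time_bound_arith[OF p _ C(1), of "real n"] by (intro ennreal_leI) simp
      finally show ?thesis .
    qed
    show "expected_time (sampling_time p r) (random_run prep_prog samp_prog k n w p)
        \<le> ennreal (C * ((\<Sum>i<n. w i) / real p + (1 + log 2 (real p))))" if r: "r < k" for k r
    proof -
      have "expected_time (sampling_time p r) (random_run prep_prog samp_prog k n w p)
          \<le> ennreal (14 + ln (real p) + (exp \<kappa> - 1) * (\<Sum>i<n. w i) / real p + 1)"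
        unfolding run sampling_time_def[abs_def]
      proof (rule expected_time_slowest[OF p _ \<kappa> _ sR])
        fix f q
        show "expect (run_pe prep_prog samp_prog k w (local_items n f q)) (\<lambda>x. ennreal (exp (real (snd (snd x ! r)))))
            \<le> ennreal (exp (14 + \<kappa> * (\<Sum>i\<leftarrow>local_items n f q. w i)))"
          unfolding \<kappa>_def by (rule time_run_pe[OF local_items(1) wl r])
      qed (use w in simp_all)
      also have "\<dots> \<le> ennreal (C * ((\<Sum>i<n. w i) / real p + (1 + log 2 (real p))))"
        using w by (intro ennreal_leI time_bound_arith[OF p _ C(2)] sum_nonneg) auto
      finally show ?thesis .
    qed
  qed
qed

end
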